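(* Let $\mathbf{A}\mathbf{X}\mathbf{B}=\mathbf{C}$ be a two-sided matrix equation, where $\mathbf{A}\in\mathbf{H}^{m\times m}$, $\mathbf{B}\in\mathbf{H}^{n\times n}$, $\mathbf{C}\in\mathbf{H}^{m\times n}$ are given, $\mathbf{X}=(x_{ij})\in\mathbf{H}^{m\times n}$ is unknown, and $\mathbf{A}$, $\mathbf{B}$ are Hermitian. If $\det\mathbf{A}\neq0$ and $\det\mathbf{B}\neq 0$, then the unique solution of the equation can be represented, for all $i=1,\dots,m$ and $j=1,\dots,n$, as $$x_{ij}=\frac{\mathrm{rdet}_j\,\mathbf{B}_{j.}\left(\mathbf{c}^{\mathbf{A}}_{i.}\right)}{\det\mathbf{A}\cdot\det\mathbf{B}},\qquad\text{or}\qquad x_{ij}=\frac{\mathrm{cdet}_i\,\mathbf{A}_{.i}\left(\mathbf{c}^{\mathbf{B}}_{.j}\right)}{\det\mathbf{A}\cdot\det\mathbf{B}},$$ where $\mathbf{c}^{\mathbf{A}}_{i.}:=\left(\mathrm{cdet}_i\,\mathbf{A}_{.i}(\mathbf{c}_{.1}),\ldots,\mathrm{cdet}_i\,\mathbf{A}_{.i}(\mathbf{c}_{.n})\right)\in\mathbf{H}^{1\times n}$ is a row-vector, $\mathbf{c}^{\mathbf{B}}_{.j}:=\left(\mathrm{rdet}_j\,\mathbf{B}_{j.}(\mathbf{c}_{1.}),\ldots,\mathrm{rdet}_j\,\mathbf{B}_{j.}(\mathbf{c}_{m.})\right)^T\in\mathbf{H}^{m\times 1}$ is a column-vector, and $\mathbf{c}_{i.}$,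 $\mathbf{c}_{.j}$ are the $i$-th row and the $j$-th column of $\mathbf{C}$.
   Context: $\mathbf{H}$ denotes the coquaternions (split quaternions): the associative real algebra with basis $1,i,j,k$ and $i^2=-1$, $j^2=k^2=1$, $ij=-ji=k$, $jk=-kj=-i$, $ik=-ki=-j$. The conjugate of $q=q_0+q_1i+q_2j+q_3k$ is $\overline{q}=q_0-q_1i-q_2j-q_3k$. $\mathbf{A}^*=(\overline{a_{ji}})$ is the conjugate transpose of $\mathbf{A}=(a_{ij})$, and a square matrix $\mathbf{A}$ is Hermitian if $\mathbf{A}^*=\mathbf{A}$. Row and column determinants of $\mathbf{A}\in\mathbf{H}^{n\times n}$. For a cycle $\gamma$ (possibly a fixed point) of a permutation and an element $s$ of $\gamma$, put $a_\gamma^{(s)}=a_{s\,\gamma(s)}\,a_{\gamma(s)\,\gamma^2(s)}\cdots a_{\gamma^{-1}(s)\,s}$ (equal to $a_{ss}$ for a fixed point). Given an index $i$, write $\sigma\in S_n$ as a product of its $r$ disjoint cycles (fixed points included) $\gamma_1,\dots,\gamma_r$, where $\gamma_1$ contains $i$ and the minimal elements $m_t$ of $\gamma_t$ satisfy $m_2<m_3<\dots<m_r$. Then $\mathrm{rdet}_i\,\mathbf{A}=\sum_{\sigma\in S_n}(-1)^{n-r}a_{\gamma_1}^{(i)}a_{\gamma_2}^{(m_2)}\cdots a_{\gamma_r}^{(m_r)}$ and $\mathrm{cdet}_i\,\mathbf{A}=\sum_{\sigma\in S_n}(-1)^{n-r}a_{\gamma_r}^{(m_r)}\cdots a_{\gamma_2}^{(m_2)}a_{\gamma_1}^{(i)}$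 (factors multiplied in the order written). For Hermitian $\mathbf{A}$ it is known that all $\mathrm{rdet}_i\,\mathbf{A}$ and $\mathrm{cdet}_i\,\mathbf{A}$ coincide and are real; the common value is denoted $\det\mathbf{A}$. $\mathbf{A}_{.i}(\mathbf{c})$ (resp. $\mathbf{B}_{j.}(\mathbf{c})$) is the matrix obtained by replacing the $i$-th column of $\mathbf{A}$ (resp. the $j$-th row of $\mathbf{B}$) with the vector $\mathbf{c}$. *)

theory Defs
  imports
    "Jordan_Normal_Form.Determinant"
    "HOL-Combinatorics.Orbits"
begin

section \<open>Coquaternions\<close>

text \<open>\<open>Coquat a b c d\<close> stands for \<open>a + b i + c j + d k\<close>.\<close>

datatype coquat = Coquat (cq0: real) (cq1: real) (cq2: real) (cq3: real)

instantiation coquat :: real_algebra_1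
begin

definition zero_coquat :: coquat where
  "0 = Coquat 0 0 0 0"

definition one_coquat :: coquat where
  "1 = Coquat 1 0 0 0"

definition plus_coquat :: "coquat \<Rightarrow> coquat \<Rightarrow> coquat" where
  "p + q = Coquat (cq0 p + cq0 q) (cq1 p + cq1 q) (cq2 p + cq2 q) (cq3 p + cq3 q)"

definition uminus_coquat :: "coquat \<Rightarrow> coquat" where
  "- q = Coquat (- cq0 q) (- cq1 q) (- cq2 q) (- cq3 q)"

definition minus_coquat :: "coquat \<Rightarrow> coquat \<Rightarrow> coquat" where
  "p - q = Coquat (cq0 p - cq0 q) (cq1 p - cq1 q) (cq2 p - cq2 q) (cq3 p - cq3 q)"

definition scaleR_coquat :: "real \<Rightarrow> coquat \<Rightarrow> coquat" where
  "r *\<^sub>R q = Coquat (r * cq0 q) (r * cq1 q) (r * cq2 q) (r * cq3 q)"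

text \<open>The bilinear extension of the multiplication table of \<open>1, i, j, k\<close>; the table itself is
  the lemma \<open>coquat_basis_mult\<close> below.\<close>

definition times_coquat :: "coquat \<Rightarrow> coquat \<Rightarrow> coquat" where
  "p * q = Coquat
     (cq0 p * cq0 q - cq1 p * cq1 q + cq2 p * cq2 q + cq3 p * cq3 q)
     (cq0 p * cq1 q + cq1 p * cq0 q - cq2 p * cq3 q + cq3 p * cq2 q)
     (cq0 p * cq2 q - cq1 p * cq3 q + cq2 p * cq0 q + cq3 p * cq1 q)
     (cq0 p * cq3 q + cq1 p * cq2 q - cq2 p * cq1 q + cq3 p * cq0 q)"

instance
  by standard
    (simp_all add: zero_coquat_def one_coquat_def plus_coquat_def uminus_coquat_def
      minus_coquat_def scaleR_coquat_def times_coquat_def algebra_simps)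

end

definition cq_i :: coquat where "cq_i = Coquat 0 1 0 0"
definition cq_j :: coquat where "cq_j = Coquat 0 0 1 0"
definition cq_k :: coquat where "cq_k = Coquat 0 0 0 1"

lemma coquat_basis_mult:
  "cq_i * cq_i = - 1" "cq_j * cq_j = 1" "cq_k * cq_k = 1"
  "cq_i * cq_j = cq_k" "cq_j * cq_i = - cq_k"
  "cq_j * cq_k = - cq_i" "cq_k * cq_j = cq_i"
  "cq_i * cq_k = - cq_j" "cq_k * cq_i = cq_j"
  by (simp_all add: cq_i_def cq_j_def cq_k_def one_coquat_def uminus_coquat_def times_coquat_def)

lemma coquat_basis_expansion:
  "q = of_real (cq0 q) + cq1 q *\<^sub>R cq_i + cq2 q *\<^sub>R cq_j + cq3 q *\<^sub>R cq_k"
  by (simp add: of_real_def cq_i_def cq_j_def cq_k_def one_coquat_def plus_coquat_def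
      scaleR_coquat_def)

definition cq_cnj :: "coquat \<Rightarrow> coquat" where
  "cq_cnj q = Coquat (cq0 q) (- cq1 q) (- cq2 q) (- cq3 q)"

section \<open>Matrices over the coquaternions\<close>

text \<open>The library's \<open>mat_adjoint\<close> is not applicable: it is restricted to fields with a
  multiplicative conjugation, whereas \<open>cq_cnj\<close> reverses products.\<close>

definition cq_adjoint :: "coquat mat \<Rightarrow> coquat mat" where
  "cq_adjoint A = mat (dim_col A) (dim_row A) (\<lambda>(i, j). cq_cnj (A $$ (j, i)))"

definition cq_hermitian :: "coquat mat \<Rightarrow> bool" where
  "cq_hermitian A \<longleftrightarrow> square_mat A \<and> cq_adjoint A = A"

text \<open>Row analogue of \<^const>\<open>replace_col\<close>.\<close>

definition replace_row :: "'a mat \<Rightarrow> 'a vec \<Rightarrow> nat \<Rightarrow> 'a mat" where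
  "replace_row A b k =
     mat (dim_row A) (dim_col A) (\<lambda>(i, j). if i = k then b $ j else A $$ (i, j))"

section \<open>Row and column determinants\<close>

text \<open>Indices range over \<open>{0..<n}\<close>. For a permutation \<open>\<sigma>\<close> of \<open>{0..<n}\<close>, the set \<open>orbit \<sigma> s\<close>
  contains \<open>s\<close> and is the cycle of \<open>\<sigma>\<close> through \<open>s\<close>.\<close>

definition perm_cycles :: "nat \<Rightarrow> (nat \<Rightarrow> nat) \<Rightarrow> nat set set" where
  "perm_cycles n \<sigma> = orbit \<sigma> ` {0..<n}"

text \<open>The product \<open>a(s, \<sigma> s) a(\<sigma> s, \<sigma>\<^sup>2 s) \<dots> a(\<sigma>\<^sup>-\<^sup>1 s, s)\<close>.\<close>

definition cycle_prod :: "coquat mat \<Rightarrow> (nat \<Rightarrow> nat) \<Rightarrow> nat \<Rightarrow> coquat" where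
  "cycle_prod A \<sigma> s =
     prod_list (map (\<lambda>t. A $$ ((\<sigma> ^^ t) s, (\<sigma> ^^ Suc t) s)) [0..<card (orbit \<sigma> s)])"

text \<open>The starting points \<open>[i, m\<^sub>2, \<dots>, m\<^sub>r]\<close>: \<open>i\<close> for its own cycle, followed by the minima of the
  other cycles in increasing order.\<close>

definition cycle_starts :: "nat \<Rightarrow> nat \<Rightarrow> (nat \<Rightarrow> nat) \<Rightarrow> nat list" where
  "cycle_starts n i \<sigma> = i # sorted_list_of_set (Min ` (perm_cycles n \<sigma> - {orbit \<sigma> i}))"

definition rdet :: "nat \<Rightarrow> coquat mat \<Rightarrow> coquat" where
  "rdet i A = (let n = dim_row A in
     \<Sum>\<sigma> | \<sigma> permutes {0..<n}.
       (- 1) ^ (n - card (perm_cycles n \<sigma>)) *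
       prod_list (map (cycle_prod A \<sigma>) (cycle_starts n i \<sigma>)))"

definition cdet :: "nat \<Rightarrow> coquat mat \<Rightarrow> coquat" where
  "cdet i A = (let n = dim_row A in
     \<Sum>\<sigma> | \<sigma> permutes {0..<n}.
       (- 1) ^ (n - card (perm_cycles n \<sigma>)) *
       prod_list (map (cycle_prod A \<sigma>) (rev (cycle_starts n i \<sigma>))))"

text \<open>The common real value of all row and column determinants; meaningful for Hermitian matrices
  of positive size.\<close>

definition hdet :: "coquat mat \<Rightarrow> real" where
  "hdet A = (THE d. \<forall>i<dim_row A. rdet i A = of_real d \<and> cdet i A = of_real d)"

end

theory Submission
  imports Defs "HOL-Combinatorics.Cycles"
begin

text \<open>
  Splitting off the cycle through \<open>i\<close> expands a row determinant as
  \<open>\<Sum> (-1)\<^bsup>|xs|\<^esup> a(i, x\<^sub>1) a(x\<^sub>1, x\<^sub>2) \<dots> a(x\<^sub>k, i) D(T - {i} - xs)\<close>, where \<open>xs\<close> ranges over the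
  repetition-free lists in \<open>T - {i}\<close> and \<open>D\<close> is the row determinant of the remaining indices,
  started at their minimum. For Hermitian \<open>a\<close>, reversing \<open>xs\<close> conjugates the cycle product, so by
  induction \<open>D\<close> is real; hence the cycle products may be replaced by their real parts, which do not
  depend on the starting point, and \<open>D\<close> does not depend on \<open>i\<close>. Replacing row \<open>i\<close> by row \<open>k \<noteq> i\<close>
  gives \<open>0\<close>: a path \<open>k, ys, k, xs, i\<close> cancels against the path \<open>k, xs, i\<close> together with the cycle
  \<open>k, ys\<close> taken from the expansion at \<open>k\<close> of the real, hence central, factor \<open>D\<close>. So the cofactors
  form a right inverse of \<open>a\<close>. Conjugation exchanges row and column determinants and yields a left
  inverse, and both formulas are the entries of \<open>A\<^sup>-\<^sup>1 C B\<^sup>-\<^sup>1\<close>, bracketed in the two possible ways.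
\<close>

section \<open>Conjugation and real part\<close>

lemma cq_cnj_simps [simp]:
  "cq_cnj (cq_cnj q) = q" "cq_cnj 0 = 0" "cq_cnj 1 = 1"
  "cq_cnj (p + q) = cq_cnj p + cq_cnj q"
  "cq_cnj (p * q) = cq_cnj q * cq_cnj p"
  "cq_cnj (r *\<^sub>R q) = r *\<^sub>R cq_cnj q"
  "cq_cnj (of_real r) = of_real r"
  by (simp_all add: cq_cnj_def zero_coquat_def one_coquat_def plus_coquat_def times_coquat_def
      scaleR_coquat_def of_real_def algebra_simps)

lemma cq_cnj_sum: "cq_cnj (sum f S) = (\<Sum>x\<in>S. cq_cnj (f x))"
  by (induction S rule: infinite_finite_induct) simp_all

lemma cq0_simps [simp]:
  "cq0 0 = 0" "cq0 1 = 1" "cq0 (p + q) = cq0 p + cq0 q"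
  "cq0 (r *\<^sub>R q) = r * cq0 q" "cq0 (of_real r) = r"
  by (simp_all add: zero_coquat_def one_coquat_def plus_coquat_def scaleR_coquat_def of_real_def)

lemma cq0_sum: "cq0 (sum f S) = (\<Sum>x\<in>S. cq0 (f x))"
  by (induction S rule: infinite_finite_induct) simp_all

text \<open>The real part is a trace form. This makes the real part of a cycle product independent
  of the element at which the cycle is cut.\<close>

lemma cq0_mult_commute: "cq0 (p * q) = cq0 (q * p)"
  by (simp add: times_coquat_def)

lemma cq_cnj_fixed_imp_real:
  assumes "cq_cnj q = q" shows "q = of_real (cq0 q)"
  using assms
  by (cases q) (simp add: cq_cnj_def of_real_def one_coquat_def scaleR_coquat_def)

lemma minus_one_power_mult: "(- 1) ^ k * (q :: 'a :: real_algebra_1) = (- 1) ^ k *\<^sub>R q"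
  by (induction k) simp_all

section \<open>Products along paths\<close>

text \<open>\<open>path_prod a i xs i\<close> is the product around the cycle \<open>i # xs\<close>.
  The ends are separate arguments so that a cycle can be cut in two and a path may start in another
  row.\<close>

fun path_prod :: "('a \<Rightarrow> 'a \<Rightarrow> coquat) \<Rightarrow> 'a \<Rightarrow> 'a list \<Rightarrow> 'a \<Rightarrow> coquat" where
  "path_prod a x [] y = a x y"
| "path_prod a x (z # zs) y = a x z * path_prod a z zs y"

lemma path_prod_append:
  "path_prod a x (ys @ z # zs) y = path_prod a x ys z * path_prod a z zs y"
  by (induction ys arbitrary: x) (simp_all add: mult.assoc)

lemma path_prod_cong:
  assumes "\<And>u v. u \<in> insert x (set zs) \<Longrightarrow> v \<in> insert y (set zs) \<Longrightarrow> a u v = b u v"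
  shows "path_prod a x zs y = path_prod b x zs y"
  using assms
proof (induction zs arbitrary: x)
  case (Cons z zs)
  have "path_prod a z zs y = path_prod b z zs y"
    by (rule Cons.IH) (use Cons.prems in auto)
  with Cons.prems show ?case by simp
qed simp

text \<open>Conjugation reverses products, so the path is walked backwards through the conjugate
  transposed entries.\<close>

lemma cq_cnj_path_prod:
  assumes "\<And>u v. u \<in> insert x (set zs) \<Longrightarrow> v \<in> insert y (set zs) \<Longrightarrow> b v u = cq_cnj (a u v)"
  shows "cq_cnj (path_prod a x zs y) = path_prod b y (rev zs) x"
  using assms
proof (induction zs arbitrary: x)
  case (Cons z zs)
  have "cq_cnj (path_prod a z zs y) = path_prod b y (rev zs) z"
    by (rule Cons.IH) (use Cons.prems in auto)
  with Cons.prems show ?case by (simp add: path_prod_append)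
qed simp

text \<open>Turns a product over iterates, the form used in \<open>cycle_prod\<close>, into a path.
  The offset \<open>m\<close> serves the induction.\<close>

lemma path_prod_upt:
  "path_prod a (f m) (map f [Suc m..<m + Suc k]) (f (m + Suc k)) =
     prod_list (map (\<lambda>t. a (f t) (f (Suc t))) [m..<m + Suc k])"
proof (induction k arbitrary: m)
  case 0
  then show ?case by simp
next
  case (Suc k)
  have "[m..<m + Suc (Suc k)] = m # [Suc m..<Suc m + Suc k]"
    "[Suc m..<m + Suc (Suc k)] = Suc m # [Suc (Suc m)..<Suc m + Suc k]"
    by (simp_all add: upt_conv_Cons del: upt_Suc)
  moreover have "m + Suc (Suc k) = Suc m + Suc k" by simp
  ultimately show ?case
    using Suc.IH[of "Suc m"] by (simp del: upt_Suc)
qed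

section \<open>Sums over repetition-free lists\<close>

text \<open>With \<open>S = T - {i}\<close> these lists encode the possible cycles through
  \<open>i\<close> inside \<open>T\<close>: each records what follows \<open>i\<close> up to the
  return.\<close>

definition distinct_lists :: "'a set \<Rightarrow> 'a list set" where
  "distinct_lists S = {xs. set xs \<subseteq> S \<and> distinct xs}"

definition distinct_list_pairs :: "'a set \<Rightarrow> ('a list \<times> 'a list) set" where
  "distinct_list_pairs S = {(xs, ys). set xs \<subseteq> S \<and> set ys \<subseteq> S \<and> distinct (xs @ ys)}"

lemma finite_distinct_lists: "finite S \<Longrightarrow> finite (distinct_lists S)"
  unfolding distinct_lists_def by (rule finite_subset_distinct)

lemma finite_distinct_list_pairs: "finite S \<Longrightarrow> finite (distinct_list_pairs S)"
  by (rule finite_subset[of _ "distinct_lists S \<times> distinct_lists S"])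
    (auto simp: distinct_list_pairs_def distinct_lists_def intro!: finite_subset_distinct)

lemma sum_rev_distinct_lists:
  "(\<Sum>xs\<in>distinct_lists S. f (rev xs)) = (\<Sum>xs\<in>distinct_lists S. f xs)"
  by (rule sum.reindex_bij_witness[where i = rev and j = rev]) (auto simp: distinct_lists_def)

lemma sum_distinct_list_pairs:
  assumes "finite S"
  shows "(\<Sum>xs\<in>distinct_lists S. \<Sum>ys\<in>distinct_lists (S - set xs). g xs ys) =
    (\<Sum>(xs, ys)\<in>distinct_list_pairs S. g xs ys)"
proof -
  have "distinct_list_pairs S = (SIGMA xs:distinct_lists S. distinct_lists (S - set xs))"
    by (auto simp: distinct_list_pairs_def distinct_lists_def)
  then show ?thesis
    using assms by (simp add: sum.Sigma finite_distinct_lists)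
qed

lemma sum_distinct_list_pairs_swap:
  "(\<Sum>(xs, ys)\<in>distinct_list_pairs S. g xs ys) = (\<Sum>(xs, ys)\<in>distinct_list_pairs S. g ys xs)"
  by (rule sum.reindex_bij_witness[where i = prod.swap and j = prod.swap])
    (auto simp: distinct_list_pairs_def)

text \<open>A repetition-free list either avoids \<open>j\<close> or is cut in a unique way at its
  only occurrence of \<open>j\<close>.\<close>

lemma sum_distinct_lists_split:
  fixes f :: "'a list \<Rightarrow> 'b :: comm_monoid_add"
  assumes "finite S" "j \<in> S"
  shows "sum f (distinct_lists S) = sum f (distinct_lists (S - {j})) +
    (\<Sum>(ys, zs)\<in>distinct_list_pairs (S - {j}). f (ys @ j # zs))"
proof -
  let ?h = "\<lambda>(ys, zs). ys @ j # zs"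
  have "distinct_lists S \<subseteq> distinct_lists (S - {j}) \<union> ?h ` distinct_list_pairs (S - {j})"
  proof
    fix xs assume xs: "xs \<in> distinct_lists S"
    show "xs \<in> distinct_lists (S - {j}) \<union> ?h ` distinct_list_pairs (S - {j})"
    proof (cases "j \<in> set xs")
      case True
      then obtain ys zs where "xs = ys @ j # zs" by (meson split_list)
      with xs have "(ys, zs) \<in> distinct_list_pairs (S - {j})"
        by (auto simp: distinct_list_pairs_def distinct_lists_def)
      with \<open>xs = ys @ j # zs\<close> show ?thesis by force
    qed (use xs in \<open>auto simp: distinct_lists_def\<close>)
  qed
  moreover have "distinct_lists (S - {j}) \<union> ?h ` distinct_list_pairs (S - {j}) \<subseteq> distinct_lists S"
    using \<open>j \<in> S\<close> by (auto simp: distinct_list_pairs_def distinct_lists_def)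
  ultimately have eq: "distinct_lists S = distinct_lists (S - {j}) \<union> ?h ` distinct_list_pairs (S - {j})"
    by blast
  have inj: "inj_on ?h (distinct_list_pairs (S - {j}))"
  proof (rule inj_onI, clarify)
    fix ys zs ys' zs'
    assume "(ys, zs) \<in> distinct_list_pairs (S - {j})" "(ys', zs') \<in> distinct_list_pairs (S - {j})"
      "ys @ j # zs = ys' @ j # zs'"
    moreover from calculation have "j \<notin> set ys" "j \<notin> set zs" "j \<notin> set ys'" "j \<notin> set zs'"
      by (auto simp: distinct_list_pairs_def)
    ultimately show "ys = ys' \<and> zs = zs'"
      by (simp add: append_Cons_eq_iff)
  qed
  have "sum f (distinct_lists S) =
      sum f (distinct_lists (S - {j})) + sum f (?h ` distinct_list_pairs (S - {j}))"
    unfolding eq using assms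
    by (intro sum.union_disjoint)
      (auto simp: distinct_lists_def finite_distinct_list_pairs intro!: finite_subset_distinct)
  also have "sum f (?h ` distinct_list_pairs (S - {j})) =
      (\<Sum>(ys, zs)\<in>distinct_list_pairs (S - {j}). f (ys @ j # zs))"
    by (subst sum.reindex[OF inj]) (simp add: case_prod_unfold o_def)
  finally show ?thesis .
qed

section \<open>Splitting off a cycle of a permutation\<close>

text \<open>The exponents start at 1, so \<open>s\<close> is left out and a fixed point has the
  empty tail.\<close>

definition cycle_tail :: "('a \<Rightarrow> 'a) \<Rightarrow> 'a \<Rightarrow> 'a list" where
  "cycle_tail \<sigma> s = map (\<lambda>t. (\<sigma> ^^ t) s) [1..<card (orbit \<sigma> s)]"

text \<open>Connects \<open>support\<close>, a list of length \<open>least_power\<close>, with the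
  orbits in terms of which the determinants are defined.\<close>

lemma least_power_eq_card_orbit:
  assumes "permutation \<sigma>" shows "least_power \<sigma> s = card (orbit \<sigma> s)"
proof -
  have "orbit \<sigma> s = set (support \<sigma> s)"
    unfolding support_set[OF assms] orbit_altdef_permutation[OF assms] by auto
  then show ?thesis
    using distinct_card[OF cycle_of_permutation[OF assms, of s]] by simp
qed

lemma Cons_cycle_tail:
  assumes "permutation \<sigma>" shows "s # cycle_tail \<sigma> s = support \<sigma> s"
proof -
  have "0 < card (orbit \<sigma> s)"
    using least_power_of_permutation(2)[OF assms, of s] least_power_eq_card_orbit[OF assms] by metis
  then show ?thesis
    unfolding cycle_tail_def least_power_eq_card_orbit[OF assms] by (simp add: upt_conv_Cons)
qed

lemma distinct_cycle_tail:
  assumes "permutation \<sigma>" shows "distinct (s # cycle_tail \<sigma> s)"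
  unfolding Cons_cycle_tail[OF assms] by (rule cycle_of_permutation[OF assms])

lemma set_cycle_tail:
  assumes "permutation \<sigma>" shows "set (s # cycle_tail \<sigma> s) = orbit \<sigma> s"
  unfolding Cons_cycle_tail[OF assms] support_set[OF assms] orbit_altdef_permutation[OF assms]
  by auto

text \<open>The list determines the permutation on this orbit; this is why splitting off a cycle
  loses no information.\<close>

lemma cycle_of_list_cycle_tail:
  assumes "permutation \<sigma>"
  shows "cycle_of_list (s # cycle_tail \<sigma> s) = perm_restrict \<sigma> (orbit \<sigma> s)"
proof
  fix x
  show "cycle_of_list (s # cycle_tail \<sigma> s) x = perm_restrict \<sigma> (orbit \<sigma> s) x"
    unfolding set_cycle_tail[OF assms, symmetric] unfolding Cons_cycle_tail[OF assms]
    by (metis assms cycle_restrict id_outside_supp perm_restrict_def)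
qed

text \<open>The \<open>t\<close>-th power rotates the list by \<open>t\<close> places, and the
  rotated list begins with the old entry at position \<open>t\<close>.\<close>

lemma funpow_cycle_of_list:
  assumes "distinct (i # xs)" "t < length (i # xs)"
  shows "(cycle_of_list (i # xs) ^^ t) i = (i # xs) ! t"
proof -
  have "(cycle_of_list (i # xs) ^^ t) i = hd (map (cycle_of_list (i # xs) ^^ t) (i # xs))"
    by simp
  also have "\<dots> = hd (rotate t (i # xs))"
    by (simp only: cyclic_rotation[OF assms(1)])
  also have "\<dots> = (i # xs) ! t"
    using assms(2) by (subst hd_rotate_conv_nth) simp_all
  finally show ?thesis .
qed

text \<open>The converse construction: glue the cycle \<open>i # xs\<close> to a permutation of the
  remaining indices. The supports are disjoint, so the iterates of \<open>i\<close> under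
  \<open>\<sigma>\<close> are those under the cycle alone.\<close>

lemma permutes_comp_cycle_of_list:
  assumes "finite T" "i \<in> T" "xs \<in> distinct_lists (T - {i})" "\<tau> permutes T - {i} - set xs"
  defines "\<sigma> \<equiv> \<tau> \<circ> cycle_of_list (i # xs)"
  shows "\<sigma> permutes T" "orbit \<sigma> i = set (i # xs)" "cycle_tail \<sigma> i = xs"
    "perm_restrict \<sigma> (T - orbit \<sigma> i) = \<tau>"
proof -
  let ?c = "cycle_of_list (i # xs)"
  have dist: "distinct (i # xs)" and sub: "set (i # xs) \<subseteq> T"
    using assms by (auto simp: distinct_lists_def)
  have c: "?c permutes set (i # xs)" by (rule cycle_permutes)
  show perm: "\<sigma> permutes T"
    unfolding \<sigma>_def
    by (intro permutes_compose permutes_subset[OF c sub] permutes_subset[OF assms(4)]) auto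
  then have "permutation \<sigma>" using \<open>finite T\<close> by (auto simp: permutation_permutes)
  have \<tau>_id: "\<tau> x = x" if "x \<in> set (i # xs)" for x
    using assms(4) that by (auto simp: permutes_def)
  have pow: "(\<sigma> ^^ t) i = (?c ^^ t) i \<and> (?c ^^ t) i \<in> set (i # xs)" for t
  proof (induction t)
    case (Suc t)
    then have "?c ((?c ^^ t) i) \<in> set (i # xs)"
      using permutes_in_image[OF c] by metis
    with Suc \<tau>_id show ?case by (simp add: \<sigma>_def)
  qed simp
  have "(?c ^^ t) i \<in> orbit \<sigma> i" for t
    using pow orbit_altdef_permutation[OF \<open>permutation \<sigma>\<close>] by (metis (mono_tags, lifting) mem_Collect_eq)
  then have "set (i # xs) \<subseteq> orbit \<sigma> i"
    by (metis funpow_cycle_of_list[OF dist] in_set_conv_nth subsetI)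
  moreover have "orbit \<sigma> i \<subseteq> set (i # xs)"
    unfolding orbit_altdef using pow by auto
  ultimately show orb: "orbit \<sigma> i = set (i # xs)" by blast
  have len: "card (orbit \<sigma> i) = length (i # xs)"
    unfolding orb by (rule distinct_card[OF dist])
  show "cycle_tail \<sigma> i = xs"
  proof (rule nth_equalityI)
    show "length (cycle_tail \<sigma> i) = length xs"
      unfolding cycle_tail_def len by (simp del: upt_Suc)
    fix t assume "t < length (cycle_tail \<sigma> i)"
    then have t: "t < length xs" unfolding cycle_tail_def len by (simp del: upt_Suc)
    then have "cycle_tail \<sigma> i ! t = (\<sigma> ^^ Suc t) i"
      unfolding cycle_tail_def len by (simp del: funpow.simps upt_Suc)
    also have "\<dots> = xs ! t"
      using pow[of "Suc t"] funpow_cycle_of_list[OF dist, of "Suc t"] t by (simp del: funpow.simps)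
    finally show "cycle_tail \<sigma> i ! t = xs ! t" .
  qed
  show "perm_restrict \<sigma> (T - orbit \<sigma> i) = \<tau>"
    unfolding orb
  proof
    fix x
    show "perm_restrict \<sigma> (T - set (i # xs)) x = \<tau> x"
    proof (cases "x \<in> T - set (i # xs)")
      case True
      then have "?c x = x" by (intro id_outside_supp) auto
      with True show ?thesis by (simp add: perm_restrict_simps \<sigma>_def)
    next
      case False
      then have "\<tau> x = x" using assms(4) by (auto simp: permutes_def)
      with False show ?thesis by (simp add: perm_restrict_simps)
    qed
  qed
qed

text \<open>A permutation of \<open>T\<close> amounts to the cycle through \<open>i\<close>, given
  as a list, and a permutation of what is left.\<close>

lemma sum_permutes_cycle_decomp:
  fixes f :: "'a list \<Rightarrow> ('a \<Rightarrow> 'a) \<Rightarrow> 'b :: comm_monoid_add"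
  assumes "finite T" "i \<in> T"
  shows "(\<Sum>\<sigma> | \<sigma> permutes T. f (cycle_tail \<sigma> i) (perm_restrict \<sigma> (T - orbit \<sigma> i))) =
    (\<Sum>xs\<in>distinct_lists (T - {i}). \<Sum>\<tau> | \<tau> permutes T - {i} - set xs. f xs \<tau>)"
proof -
  let ?P = "SIGMA xs:distinct_lists (T - {i}). {\<tau>. \<tau> permutes T - {i} - set xs}"
  have "(\<Sum>\<sigma> | \<sigma> permutes T. f (cycle_tail \<sigma> i) (perm_restrict \<sigma> (T - orbit \<sigma> i))) =
      (\<Sum>(xs, \<tau>)\<in>?P. f xs \<tau>)"
  proof (rule sum.reindex_bij_witness[where
        j = "\<lambda>\<sigma>. (cycle_tail \<sigma> i, perm_restrict \<sigma> (T - orbit \<sigma> i))" and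
        i = "\<lambda>(xs, \<tau>). \<tau> \<circ> cycle_of_list (i # xs)"], goal_cases)
    \<comment> \<open>The five obligations: gluing undoes splitting, splitting lands in
      \<open>?P\<close>, splitting undoes gluing, gluing permutes \<open>T\<close>, and the summands
      agree.\<close>
    case (1 \<sigma>)
    then have "\<sigma> permutes T" by simp
    then have \<sigma>: "permutation \<sigma>" using \<open>finite T\<close> by (auto simp: permutation_permutes)
    have "perm_restrict \<sigma> (T - orbit \<sigma> i) \<circ> perm_restrict \<sigma> (orbit \<sigma> i) =
        perm_restrict \<sigma> ((T - orbit \<sigma> i) \<union> orbit \<sigma> i)"
      by (rule perm_restrict_comp) (auto intro: cyclic_on_orbit' \<sigma>)
    also have "(T - orbit \<sigma> i) \<union> orbit \<sigma> i = T"
      using permutes_orbit_subset[OF \<open>\<sigma> permutes T\<close> \<open>i \<in> T\<close>] by blast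
    finally show ?case
      using \<open>\<sigma> permutes T\<close> by (simp add: cycle_of_list_cycle_tail[OF \<sigma>] o_def del: cycle_of_list.simps)
  next
    case (2 \<sigma>)
    then have "\<sigma> permutes T" by simp
    then have \<sigma>: "permutation \<sigma>" using \<open>finite T\<close> by (auto simp: permutation_permutes)
    have "perm_restrict \<sigma> (T - orbit \<sigma> i) permutes T - orbit \<sigma> i"
      using \<open>\<sigma> permutes T\<close> by (rule perm_restrict_diff_cyclic) (rule cyclic_on_orbit'[OF \<sigma>])
    moreover have "T - {i} - set (cycle_tail \<sigma> i) = T - orbit \<sigma> i"
      unfolding set_cycle_tail[OF \<sigma>, of i, symmetric] by auto
    moreover have "cycle_tail \<sigma> i \<in> distinct_lists (T - {i})"
      using distinct_cycle_tail[OF \<sigma>, of i] set_cycle_tail[OF \<sigma>, of i]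
        permutes_orbit_subset[OF \<open>\<sigma> permutes T\<close> \<open>i \<in> T\<close>]
      by (auto simp: distinct_lists_def)
    ultimately show ?case by simp
  next
    case (3 b)
    then show ?case
      using permutes_comp_cycle_of_list[OF assms] by (auto simp del: cycle_of_list.simps)
  next
    case (4 b)
    then show ?case
      using permutes_comp_cycle_of_list[OF assms] by (auto simp del: cycle_of_list.simps)
  next
    case (5 \<sigma>)
    then show ?case by simp
  qed
  then show ?thesis
    using assms by (simp add: sum.Sigma finite_distinct_lists finite_permutations)
qed

text \<open>The iterates of \<open>s\<close> never enter the orbit of \<open>i\<close>, so they do
  not notice that this orbit has been removed.\<close>

lemma
  assumes "finite T" "\<sigma> permutes T" "s \<in> T - orbit \<sigma> i"
  defines "\<tau> \<equiv> perm_restrict \<sigma> (T - orbit \<sigma> i)"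
  shows orbit_perm_restrict: "orbit \<tau> s = orbit \<sigma> s"
    and cycle_tail_perm_restrict: "cycle_tail \<tau> s = cycle_tail \<sigma> s"
proof -
  have \<tau>: "\<tau> permutes T - orbit \<sigma> i"
    unfolding \<tau>_def using assms(2) by (rule perm_restrict_diff_cyclic) (rule cyclic_on_orbit[OF assms(2,1)])
  have \<tau>_eq: "\<tau> x = \<sigma> x" if "x \<in> T - orbit \<sigma> i" for x
    unfolding \<tau>_def using that by (rule perm_restrict_simps(1))
  have pow: "(\<tau> ^^ t) s = (\<sigma> ^^ t) s \<and> (\<tau> ^^ t) s \<in> T - orbit \<sigma> i" for t
  proof (induction t)
    case (Suc t)
    then have "\<tau> ((\<tau> ^^ t) s) \<in> T - orbit \<sigma> i"
      using permutes_in_image[OF \<tau>] by metis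
    moreover have "\<tau> ((\<tau> ^^ t) s) = \<sigma> ((\<tau> ^^ t) s)"
      using Suc \<tau>_eq by blast
    ultimately show ?case using Suc by simp
  qed (use assms in simp)
  then show orb: "orbit \<tau> s = orbit \<sigma> s"
    unfolding orbit_altdef by simp
  show "cycle_tail \<tau> s = cycle_tail \<sigma> s"
    unfolding cycle_tail_def orb using pow by simp
qed

lemma orbit_eq_iff:
  assumes "permutation \<sigma>" shows "orbit \<sigma> s = orbit \<sigma> i \<longleftrightarrow> s \<in> orbit \<sigma> i"
  using orbit_cyclic_eq3[OF cyclic_on_orbit'[OF assms]] permutation_self_in_orbit[OF assms] by metis

lemma orbits_perm_restrict:
  assumes "finite T" "\<sigma> permutes T"
  shows "orbit (perm_restrict \<sigma> (T - orbit \<sigma> i)) ` (T - orbit \<sigma> i) = orbit \<sigma> ` T - {orbit \<sigma> i}"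
proof -
  have "permutation \<sigma>" using assms by (auto simp: permutation_permutes)
  have "orbit (perm_restrict \<sigma> (T - orbit \<sigma> i)) ` (T - orbit \<sigma> i) = orbit \<sigma> ` (T - orbit \<sigma> i)"
    by (rule image_cong[OF refl]) (rule orbit_perm_restrict[OF assms])
  also have "\<dots> = orbit \<sigma> ` T - {orbit \<sigma> i}"
    using orbit_eq_iff[OF \<open>permutation \<sigma>\<close>] by blast
  finally show ?thesis .
qed

text \<open>The least of all cycle minima is \<open>Min T\<close>. Hence listing every cycle by its
  minimum agrees with distinguishing the index \<open>Min T\<close>.\<close>

lemma sorted_list_of_set_orbit_minima:
  assumes "finite T" "T \<noteq> {}" "\<sigma> permutes T"
  shows "sorted_list_of_set (Min ` orbit \<sigma> ` T) =
    Min T # sorted_list_of_set (Min ` (orbit \<sigma> ` T - {orbit \<sigma> (Min T)}))"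
proof -
  let ?m = "Min T"
  have \<sigma>: "permutation \<sigma>" using assms by (auto simp: permutation_permutes)
  have m: "?m \<in> T" using assms by simp
  have sub: "orbit \<sigma> s \<subseteq> T" if "s \<in> T" for s
    using permutes_orbit_subset[OF assms(3) that] .
  have min_in: "Min (orbit \<sigma> s) \<in> orbit \<sigma> s" if "s \<in> T" for s
    using finite_subset[OF sub[OF that] assms(1)] orbit_nonempty[of \<sigma> s] by (rule Min_in)
  have min_m: "Min (orbit \<sigma> ?m) = ?m"
  proof (rule Min_eqI)
    show "finite (orbit \<sigma> ?m)" using finite_subset[OF sub[OF m] assms(1)] .
    show "?m \<le> y" if "y \<in> orbit \<sigma> ?m" for y
      using sub[OF m] that assms by auto
    show "?m \<in> orbit \<sigma> ?m" using permutation_self_in_orbit[OF \<sigma>] .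
  qed
  have "Min (Min ` orbit \<sigma> ` T) = ?m"
  proof (rule Min_eqI)
    show "finite (Min ` orbit \<sigma> ` T)" using assms by simp
    show "?m \<le> y" if "y \<in> Min ` orbit \<sigma> ` T" for y
    proof -
      from that obtain s where "s \<in> T" "y = Min (orbit \<sigma> s)" by auto
      with min_in sub have "y \<in> T" by blast
      then show ?thesis using assms by simp
    qed
    show "?m \<in> Min ` orbit \<sigma> ` T" using m min_m by (metis image_eqI)
  qed
  moreover have "Min ` orbit \<sigma> ` T - {?m} = Min ` (orbit \<sigma> ` T - {orbit \<sigma> ?m})"
  proof -
    \<comment> \<open>An orbit with minimum \<open>?m\<close> contains \<open>?m\<close> and is
      therefore the orbit of \<open>?m\<close>.\<close>
    have "Min (orbit \<sigma> s) \<noteq> ?m" if "s \<in> T" "orbit \<sigma> s \<noteq> orbit \<sigma> ?m" for s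
      using min_in[OF that(1)] that(2) orbit_eq_iff[OF \<sigma>] by metis
    then show ?thesis using min_m by auto
  qed
  ultimately show ?thesis
    using sorted_list_of_set_nonempty[of "Min ` orbit \<sigma> ` T"] assms by simp
qed

section \<open>Signed permutation sums and their expansion along one cycle\<close>

definition perm_sum ::
  "(coquat list \<Rightarrow> coquat) \<Rightarrow> (nat \<Rightarrow> nat \<Rightarrow> coquat) \<Rightarrow> nat set \<Rightarrow> coquat" where
  "perm_sum g a T = (\<Sum>\<sigma> | \<sigma> permutes T. (- 1) ^ (card T - card (orbit \<sigma> ` T)) *\<^sub>R
     g (map (\<lambda>s. path_prod a s (cycle_tail \<sigma> s) s) (sorted_list_of_set (Min ` orbit \<sigma> ` T))))"

text \<open>The cycle \<open>i # xs\<close> becomes the first factor and contributes the sign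
  \<open>(- 1) ^ length xs\<close>. The other cycles keep their minima and their order, so they form
  a sum of the same kind, with the first factor absorbed into \<open>g\<close>.\<close>

lemma perm_sum_expand_cycle:
  assumes "finite T" "i \<in> T"
  shows "(\<Sum>\<sigma> | \<sigma> permutes T. (- 1) ^ (card T - card (orbit \<sigma> ` T)) *\<^sub>R
      g (map (\<lambda>s. path_prod a s (cycle_tail \<sigma> s) s)
        (i # sorted_list_of_set (Min ` (orbit \<sigma> ` T - {orbit \<sigma> i}))))) =
    (\<Sum>xs\<in>distinct_lists (T - {i}).
      (- 1) ^ length xs *\<^sub>R perm_sum (\<lambda>cs. g (path_prod a i xs i # cs)) a (T - {i} - set xs))"
proof -
  define f where "f xs \<tau> = (- 1) ^ length xs *\<^sub>R
      ((- 1) ^ (card (T - {i} - set xs) - card (orbit \<tau> ` (T - {i} - set xs))) *\<^sub>R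
        g (path_prod a i xs i # map (\<lambda>s. path_prod a s (cycle_tail \<tau> s) s)
          (sorted_list_of_set (Min ` orbit \<tau> ` (T - {i} - set xs)))))"
    for xs and \<tau> :: "nat \<Rightarrow> nat"
  have "(- 1) ^ (card T - card (orbit \<sigma> ` T)) *\<^sub>R
      g (map (\<lambda>s. path_prod a s (cycle_tail \<sigma> s) s)
        (i # sorted_list_of_set (Min ` (orbit \<sigma> ` T - {orbit \<sigma> i})))) =
      f (cycle_tail \<sigma> i) (perm_restrict \<sigma> (T - orbit \<sigma> i))" if "\<sigma> permutes T" for \<sigma>
  proof -
    let ?\<tau> = "perm_restrict \<sigma> (T - orbit \<sigma> i)" and ?U = "T - orbit \<sigma> i"
    have \<sigma>: "permutation \<sigma>" using that assms by (auto simp: permutation_permutes)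
    have U: "T - {i} - set (cycle_tail \<sigma> i) = ?U"
      unfolding set_cycle_tail[OF \<sigma>, of i, symmetric] by auto
    have sub: "orbit \<sigma> i \<subseteq> T" using permutes_orbit_subset[OF that \<open>i \<in> T\<close>] .
    have orbs: "orbit ?\<tau> ` ?U = orbit \<sigma> ` T - {orbit \<sigma> i}"
      using orbits_perm_restrict[OF \<open>finite T\<close> that] .
    have "card (orbit \<sigma> i) = Suc (length (cycle_tail \<sigma> i))"
      using distinct_card[OF distinct_cycle_tail[OF \<sigma>, of i]] unfolding set_cycle_tail[OF \<sigma>] by simp
    moreover have "card T = card (orbit \<sigma> i) + card ?U"
      using sub assms by (metis card_Diff_subset card_mono finite_subset le_add_diff_inverse)
    moreover have "card (orbit \<sigma> ` T) = Suc (card (orbit ?\<tau> ` ?U))"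
      unfolding orbs using assms by (intro card.remove) auto
    moreover have "card (orbit ?\<tau> ` ?U) \<le> card ?U"
      using assms by (intro card_image_le) auto
    \<comment> \<open>The cycle takes away \<open>Suc (length xs)\<close> indices but only one
      orbit. The truncated subtraction is harmless since there are at most as many orbits as
      indices.\<close>
    ultimately have sign: "card T - card (orbit \<sigma> ` T) =
        length (cycle_tail \<sigma> i) + (card ?U - card (orbit ?\<tau> ` ?U))"
      by linarith
    \<comment> \<open>The tails under \<open>\<sigma>\<close> and \<open>?\<tau>\<close> are only
      known to agree at starting points outside the orbit of \<open>i\<close>.\<close>
    have starts: "set (sorted_list_of_set (Min ` orbit ?\<tau> ` ?U)) \<subseteq> ?U"
    proof -
      have "Min (orbit ?\<tau> s) \<in> ?U" if "s \<in> ?U" for s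
      proof -
        have "?\<tau> permutes ?U"
          using \<open>\<sigma> permutes T\<close> by (rule perm_restrict_diff_cyclic) (rule cyclic_on_orbit'[OF \<sigma>])
        then have "orbit ?\<tau> s \<subseteq> ?U" using that by (rule permutes_orbit_subset)
        moreover from this have "finite (orbit ?\<tau> s)" using assms by (auto intro: finite_subset)
        ultimately show ?thesis using Min_in[OF _ orbit_nonempty] by blast
      qed
      then show ?thesis using assms by auto
    qed
    have "map (\<lambda>s. path_prod a s (cycle_tail \<sigma> s) s) (sorted_list_of_set (Min ` orbit ?\<tau> ` ?U)) =
        map (\<lambda>s. path_prod a s (cycle_tail ?\<tau> s) s) (sorted_list_of_set (Min ` orbit ?\<tau> ` ?U))"
    proof (rule map_cong[OF refl])
      fix s assume "s \<in> set (sorted_list_of_set (Min ` orbit ?\<tau> ` ?U))"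
      with starts have "s \<in> ?U" by (rule subsetD)
      then show "path_prod a s (cycle_tail \<sigma> s) s = path_prod a s (cycle_tail ?\<tau> s) s"
        by (simp only: cycle_tail_perm_restrict[OF \<open>finite T\<close> that])
    qed
    then show ?thesis
      unfolding f_def U sign orbs list.map by (simp only: power_add scaleR_scaleR)
  qed
  then have "(\<Sum>\<sigma> | \<sigma> permutes T. (- 1) ^ (card T - card (orbit \<sigma> ` T)) *\<^sub>R
      g (map (\<lambda>s. path_prod a s (cycle_tail \<sigma> s) s)
        (i # sorted_list_of_set (Min ` (orbit \<sigma> ` T - {orbit \<sigma> i}))))) =
      (\<Sum>\<sigma> | \<sigma> permutes T. f (cycle_tail \<sigma> i) (perm_restrict \<sigma> (T - orbit \<sigma> i)))"
    by (intro sum.cong) auto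
  also have "\<dots> = (\<Sum>xs\<in>distinct_lists (T - {i}). \<Sum>\<tau> | \<tau> permutes T - {i} - set xs. f xs \<tau>)"
    by (rule sum_permutes_cycle_decomp[OF assms])
  also have "\<dots> = (\<Sum>xs\<in>distinct_lists (T - {i}).
      (- 1) ^ length xs *\<^sub>R perm_sum (\<lambda>cs. g (path_prod a i xs i # cs)) a (T - {i} - set xs))"
    unfolding f_def perm_sum_def scaleR_sum_right ..
  finally show ?thesis .
qed

text \<open>The parameter \<open>g\<close> only fixes the order of multiplication, so both kinds of
  determinant share one expansion. Every cycle starts at its minimum, which makes sense for each
  finite index set, also the empty one.\<close>

abbreviation rdet_on :: "(nat \<Rightarrow> nat \<Rightarrow> coquat) \<Rightarrow> nat set \<Rightarrow> coquat" where
  "rdet_on \<equiv> perm_sum prod_list"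

abbreviation cdet_on :: "(nat \<Rightarrow> nat \<Rightarrow> coquat) \<Rightarrow> nat set \<Rightarrow> coquat" where
  "cdet_on \<equiv> perm_sum (\<lambda>cs. prod_list (rev cs))"

lemma perm_sum_empty: "perm_sum g a {} = g []"
  by (simp add: perm_sum_def)

text \<open>Splitting off the cycle through the least index takes the first factor, so the order of
  the factors is unchanged.\<close>

lemma perm_sum_Min:
  assumes "finite T" "T \<noteq> {}"
  shows "perm_sum g a T = (\<Sum>xs\<in>distinct_lists (T - {Min T}). (- 1) ^ length xs *\<^sub>R
    perm_sum (\<lambda>cs. g (path_prod a (Min T) xs (Min T) # cs)) a (T - {Min T} - set xs))"
proof -
  have "Min T \<in> T" using assms by simp
  show ?thesis
    unfolding perm_sum_expand_cycle[OF assms(1) \<open>Min T \<in> T\<close>, symmetric]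
    unfolding perm_sum_def[of g a T]
    by (intro sum.cong) (simp_all add: sorted_list_of_set_orbit_minima[OF assms])
qed

lemma perm_sum_mult_left: "perm_sum (\<lambda>cs. p * g cs) a T = p * perm_sum g a T"
  by (simp add: perm_sum_def sum_distrib_left)

lemma perm_sum_mult_right: "perm_sum (\<lambda>cs. g cs * p) a T = perm_sum g a T * p"
  by (simp add: perm_sum_def sum_distrib_right)

text \<open>At \<open>i = Min T\<close> this is \<open>rdet_on a T\<close> by construction; for the
  other indices of \<open>T\<close> the equality is the Hermitian result
  \<open>row_expansion_hermitian\<close>.\<close>

definition row_expansion :: "(nat \<Rightarrow> nat \<Rightarrow> coquat) \<Rightarrow> nat set \<Rightarrow> nat \<Rightarrow> coquat" where
  "row_expansion a T i = (\<Sum>xs\<in>distinct_lists (T - {i}).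
     (- 1) ^ length xs *\<^sub>R (path_prod a i xs i * rdet_on a (T - {i} - set xs)))"

definition col_expansion :: "(nat \<Rightarrow> nat \<Rightarrow> coquat) \<Rightarrow> nat set \<Rightarrow> nat \<Rightarrow> coquat" where
  "col_expansion a T i = (\<Sum>xs\<in>distinct_lists (T - {i}).
     (- 1) ^ length xs *\<^sub>R (cdet_on a (T - {i} - set xs) * path_prod a i xs i))"

lemma rdet_on_Min:
  assumes "finite T" "T \<noteq> {}" shows "rdet_on a T = row_expansion a T (Min T)"
  unfolding perm_sum_Min[OF assms] row_expansion_def by (simp add: perm_sum_mult_left)

lemma cdet_on_Min:
  assumes "finite T" "T \<noteq> {}" shows "cdet_on a T = col_expansion a T (Min T)"
  unfolding perm_sum_Min[OF assms] col_expansion_def by (simp add: perm_sum_mult_right)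

section \<open>Identifying \<open>rdet\<close> and \<open>cdet\<close> with the expansions\<close>

lemma cycle_prod_eq_path_prod:
  assumes "permutation \<sigma>"
  shows "cycle_prod A \<sigma> s = path_prod (\<lambda>i j. A $$ (i, j)) s (cycle_tail \<sigma> s) s"
proof -
  define N where "N = card (orbit \<sigma> s)"
  \<comment> \<open>The orbit size is the period of \<open>s\<close>, so the last factor of the
    cycle product returns to \<open>s\<close>. A fixed point is the case
    \<open>k = 0\<close>.\<close>
  have "0 < N" "(\<sigma> ^^ N) s = s"
    using least_power_of_permutation[OF assms, of s] least_power_eq_card_orbit[OF assms]
    unfolding N_def by metis+
  then obtain k where k: "N = Suc k" using gr0_implies_Suc by blast
  show ?thesis
    using path_prod_upt[of "\<lambda>i j. A $$ (i, j)" "\<lambda>t. (\<sigma> ^^ t) s" 0 k] \<open>(\<sigma> ^^ N) s = s\<close>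
    unfolding cycle_prod_def cycle_tail_def N_def[symmetric] k
    by (simp del: upt_Suc funpow.simps)
qed

lemma rdet_eq_row_expansion:
  assumes "i < dim_row A"
  shows "rdet i A = row_expansion (\<lambda>i j. A $$ (i, j)) {0..<dim_row A} i"
proof -
  let ?T = "{0..<dim_row A}" and ?a = "\<lambda>i j. A $$ (i, j)"
  have "rdet i A = (\<Sum>\<sigma> | \<sigma> permutes ?T. (- 1) ^ (card ?T - card (orbit \<sigma> ` ?T)) *\<^sub>R
      prod_list (map (\<lambda>s. path_prod ?a s (cycle_tail \<sigma> s) s)
        (i # sorted_list_of_set (Min ` (orbit \<sigma> ` ?T - {orbit \<sigma> i})))))"
    unfolding rdet_def Let_def perm_cycles_def cycle_starts_def minus_one_power_mult
    by (intro sum.cong refl arg_cong2[of _ _ _ _ "(*\<^sub>R)"] arg_cong[of _ _ prod_list] map_cong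
        cycle_prod_eq_path_prod) (auto simp: permutation_permutes)
  also have "\<dots> = row_expansion ?a ?T i"
    using assms by (subst perm_sum_expand_cycle) (simp_all add: row_expansion_def perm_sum_mult_left)
  finally show ?thesis .
qed

lemma cdet_eq_col_expansion:
  assumes "i < dim_row A"
  shows "cdet i A = col_expansion (\<lambda>i j. A $$ (i, j)) {0..<dim_row A} i"
proof -
  let ?T = "{0..<dim_row A}" and ?a = "\<lambda>i j. A $$ (i, j)"
  have "cdet i A = (\<Sum>\<sigma> | \<sigma> permutes ?T. (- 1) ^ (card ?T - card (orbit \<sigma> ` ?T)) *\<^sub>R
      prod_list (rev (map (\<lambda>s. path_prod ?a s (cycle_tail \<sigma> s) s)
        (i # sorted_list_of_set (Min ` (orbit \<sigma> ` ?T - {orbit \<sigma> i}))))))"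
    unfolding cdet_def Let_def perm_cycles_def cycle_starts_def minus_one_power_mult rev_map
    by (intro sum.cong refl arg_cong2[of _ _ _ _ "(*\<^sub>R)"] arg_cong[of _ _ prod_list] map_cong
        cycle_prod_eq_path_prod) (auto simp: permutation_permutes)
  also have "\<dots> = col_expansion ?a ?T i"
    using assms
    by (subst perm_sum_expand_cycle[where g = "\<lambda>cs. prod_list (rev cs)"])
      (simp_all add: col_expansion_def perm_sum_mult_right)
  finally show ?thesis .
qed

section \<open>Hermitian matrices\<close>

text \<open>Conjugation moves the minor to the left and reverses the path; reversing the summation
  list restores the path and changes neither sign nor minor. The claim for minors is a premise so
  that an induction hypothesis can supply it.\<close>

lemma col_expansion_eq_cnj_row_expansion_if_minors:
  assumes "i \<in> T"
    and adj: "\<And>u v. u \<in> T \<Longrightarrow> v \<in> T \<Longrightarrow> b v u = cq_cnj (a u v)"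
    and minors: "\<And>xs. cdet_on b (T - {i} - set xs) = cq_cnj (rdet_on a (T - {i} - set xs))"
  shows "col_expansion b T i = cq_cnj (row_expansion a T i)"
proof -
  have "cq_cnj (row_expansion a T i) = (\<Sum>xs\<in>distinct_lists (T - {i}).
      (- 1) ^ length xs *\<^sub>R (cdet_on b (T - {i} - set xs) * cq_cnj (path_prod a i xs i)))"
    by (simp add: row_expansion_def cq_cnj_sum minors)
  also have "\<dots> = (\<Sum>xs\<in>distinct_lists (T - {i}). (- 1) ^ length (rev xs) *\<^sub>R
      (cdet_on b (T - {i} - set (rev xs)) * path_prod b i (rev xs) i))"
  proof (intro sum.cong refl)
    fix xs assume "xs \<in> distinct_lists (T - {i})"
    then have "cq_cnj (path_prod a i xs i) = path_prod b i (rev xs) i"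
      using \<open>i \<in> T\<close> by (intro cq_cnj_path_prod adj) (auto simp: distinct_lists_def)
    then show "(- 1) ^ length xs *\<^sub>R (cdet_on b (T - {i} - set xs) * cq_cnj (path_prod a i xs i)) =
        (- 1) ^ length (rev xs) *\<^sub>R
          (cdet_on b (T - {i} - set (rev xs)) * path_prod b i (rev xs) i)"
      by simp
  qed
  also have "\<dots> = col_expansion b T i"
    unfolding col_expansion_def by (rule sum_rev_distinct_lists)
  finally show ?thesis ..
qed

lemma cdet_on_eq_cnj_rdet_on:
  assumes "finite T" "\<And>u v. u \<in> T \<Longrightarrow> v \<in> T \<Longrightarrow> b v u = cq_cnj (a u v)"
  shows "cdet_on b T = cq_cnj (rdet_on a T)"
  using assms
proof (induction T rule: finite_psubset_induct)
  case (psubset T)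
  show ?case
  proof (cases "T = {}")
    case False
    with \<open>finite T\<close> have m: "Min T \<in> T" by simp
    have "cdet_on b (T - {Min T} - set xs) = cq_cnj (rdet_on a (T - {Min T} - set xs))" for xs
      using m by (intro psubset.IH psubset.prems) auto
    then show ?thesis
      unfolding rdet_on_Min[OF \<open>finite T\<close> False] cdet_on_Min[OF \<open>finite T\<close> False]
      by (intro col_expansion_eq_cnj_row_expansion_if_minors m psubset.prems)
  qed (simp add: perm_sum_empty)
qed

lemma col_expansion_eq_cnj_row_expansion:
  assumes "finite T" "i \<in> T" "\<And>u v. u \<in> T \<Longrightarrow> v \<in> T \<Longrightarrow> b v u = cq_cnj (a u v)"
  shows "col_expansion b T i = cq_cnj (row_expansion a T i)"
  using assms by (intro col_expansion_eq_cnj_row_expansion_if_minors cdet_on_eq_cnj_rdet_on) auto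

text \<open>Both sides are conjugates of one column determinant, that of the conjugate transpose,
  which avoids a second induction.\<close>

lemma rdet_on_cong:
  assumes "finite T" "\<And>u v. u \<in> T \<Longrightarrow> v \<in> T \<Longrightarrow> a u v = b u v"
  shows "rdet_on a T = rdet_on b T"
proof -
  have "cq_cnj (rdet_on a T) = cq_cnj (rdet_on b T)"
    using cdet_on_eq_cnj_rdet_on[of T "\<lambda>v u. cq_cnj (a u v)" a]
      cdet_on_eq_cnj_rdet_on[of T "\<lambda>v u. cq_cnj (a u v)" b] assms by simp
  then show ?thesis by (metis cq_cnj_simps(1))
qed

section \<open>Reality and independence of the index for Hermitian entries\<close>

definition hermitian_on :: "('a \<Rightarrow> 'a \<Rightarrow> coquat) \<Rightarrow> 'a set \<Rightarrow> bool" where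
  "hermitian_on a T \<longleftrightarrow> (\<forall>u\<in>T. \<forall>v\<in>T. a v u = cq_cnj (a u v))"

lemma hermitian_on_subset: "hermitian_on a T \<Longrightarrow> U \<subseteq> T \<Longrightarrow> hermitian_on a U"
  by (auto simp: hermitian_on_def)

text \<open>When the minors are real, the terms of \<open>xs\<close> and \<open>rev xs\<close> are
  conjugate to each other.\<close>

lemma cnj_row_expansion_hermitian:
  assumes "hermitian_on a T" "i \<in> T"
    and real: "\<And>xs. rdet_on a (T - {i} - set xs) = of_real (d (T - {i} - set xs))"
  shows "cq_cnj (row_expansion a T i) = row_expansion a T i"
proof -
  have "cq_cnj (row_expansion a T i) = (\<Sum>xs\<in>distinct_lists (T - {i}).
      (- 1) ^ length (rev xs) *\<^sub>R (path_prod a i (rev xs) i * rdet_on a (T - {i} - set (rev xs))))"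
    unfolding row_expansion_def cq_cnj_sum
  proof (intro sum.cong refl)
    fix xs assume "xs \<in> distinct_lists (T - {i})"
    then have "cq_cnj (path_prod a i xs i) = path_prod a i (rev xs) i"
      using assms(1,2) by (intro cq_cnj_path_prod) (auto simp: distinct_lists_def hermitian_on_def)
    then show "cq_cnj ((- 1) ^ length xs *\<^sub>R (path_prod a i xs i * rdet_on a (T - {i} - set xs))) =
        (- 1) ^ length (rev xs) *\<^sub>R (path_prod a i (rev xs) i * rdet_on a (T - {i} - set (rev xs)))"
      by (simp add: real of_real_def)
  qed
  also have "\<dots> = row_expansion a T i"
    unfolding row_expansion_def by (rule sum_rev_distinct_lists)
  finally show ?thesis .
qed

text \<open>The commutative shadow of \<open>row_expansion\<close>: only real parts of cycle
  products remain. The function \<open>d\<close> stands for the real values of the minors.\<close>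

definition trace_expansion ::
  "(nat \<Rightarrow> nat \<Rightarrow> coquat) \<Rightarrow> (nat set \<Rightarrow> real) \<Rightarrow> nat set \<Rightarrow> nat \<Rightarrow> real" where
  "trace_expansion a d T i = (\<Sum>xs\<in>distinct_lists (T - {i}).
     (- 1) ^ length xs * cq0 (path_prod a i xs i) * d (T - {i} - set xs))"

lemma row_expansion_eq_trace_expansion:
  assumes "hermitian_on a T" "i \<in> T"
    and real: "\<And>xs. rdet_on a (T - {i} - set xs) = of_real (d (T - {i} - set xs))"
  shows "row_expansion a T i = of_real (trace_expansion a d T i)"
proof -
  have "row_expansion a T i = of_real (cq0 (row_expansion a T i))"
    by (rule cq_cnj_fixed_imp_real[OF cnj_row_expansion_hermitian[OF assms]])
  also have "cq0 (row_expansion a T i) = trace_expansion a d T i"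
    unfolding row_expansion_def trace_expansion_def cq0_sum
    by (intro sum.cong refl) (simp add: real of_real_def)
  finally show ?thesis .
qed

text \<open>Separate the cycles through both \<open>i\<close> and \<open>j\<close> from the pairs of disjoint cycles through
  \<open>i\<close> and through \<open>j\<close>: by \<open>cq0 (p q) = cq0 (q p)\<close> both parts are symmetric in \<open>i\<close> and \<open>j\<close>.\<close>

lemma trace_expansion_split:
  assumes "finite T" "i \<in> T" "j \<in> T" "i \<noteq> j"
    and expand: "\<And>xs. set xs \<subseteq> T - {i, j} \<Longrightarrow>
      d (T - {i} - set xs) = trace_expansion a d (T - {i} - set xs) j"
  shows "trace_expansion a d T i =
    (\<Sum>(xs, ys)\<in>distinct_list_pairs (T - {i, j}). (- 1) ^ (length xs + length ys) *
      (cq0 (path_prod a i xs i) * cq0 (path_prod a j ys j) -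
       cq0 (path_prod a i xs j * path_prod a j ys i)) * d (T - {i, j} - set xs - set ys))"
proof -
  let ?U = "T - {i, j}"
  have U: "T - {i} - {j} = ?U" by auto
  have "trace_expansion a d T i =
      (\<Sum>xs\<in>distinct_lists ?U. (- 1) ^ length xs * cq0 (path_prod a i xs i) * d (T - {i} - set xs)) +
      (\<Sum>(ys, zs)\<in>distinct_list_pairs ?U. (- 1) ^ length (ys @ j # zs) *
        cq0 (path_prod a i (ys @ j # zs) i) * d (T - {i} - set (ys @ j # zs)))"
    unfolding trace_expansion_def using assms(1-4)
    by (subst sum_distinct_lists_split[of _ j]) (simp_all add: U)
  \<comment> \<open>If the cycle through \<open>i\<close> avoids \<open>j\<close>, then
    \<open>j\<close> lies in the minor, which is expanded at \<open>j\<close>.\<close>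
  also have "(\<Sum>xs\<in>distinct_lists ?U.
        (- 1) ^ length xs * cq0 (path_prod a i xs i) * d (T - {i} - set xs)) =
      (\<Sum>xs\<in>distinct_lists ?U. \<Sum>ys\<in>distinct_lists (?U - set xs). (- 1) ^ (length xs + length ys) *
        (cq0 (path_prod a i xs i) * cq0 (path_prod a j ys j)) * d (?U - set xs - set ys))"
  proof (intro sum.cong refl)
    fix xs assume "xs \<in> distinct_lists ?U"
    then have "d (T - {i} - set xs) = trace_expansion a d (T - {i} - set xs) j"
      by (intro expand) (simp add: distinct_lists_def)
    moreover have "T - {i} - set xs - {j} = ?U - set xs" by auto
    ultimately show "(- 1) ^ length xs * cq0 (path_prod a i xs i) * d (T - {i} - set xs) =
        (\<Sum>ys\<in>distinct_lists (?U - set xs). (- 1) ^ (length xs + length ys) *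
          (cq0 (path_prod a i xs i) * cq0 (path_prod a j ys j)) * d (?U - set xs - set ys))"
      by (simp add: trace_expansion_def sum_distrib_left power_add mult_ac)
  qed
  also have "\<dots> = (\<Sum>(xs, ys)\<in>distinct_list_pairs ?U. (- 1) ^ (length xs + length ys) *
        (cq0 (path_prod a i xs i) * cq0 (path_prod a j ys j)) * d (?U - set xs - set ys))"
    using assms(1) by (intro sum_distinct_list_pairs) simp
  \<comment> \<open>If the cycle meets \<open>j\<close>, it is cut there into two paths; the
    additional element \<open>j\<close> produces the minus sign.\<close>
  also have "(\<Sum>(ys, zs)\<in>distinct_list_pairs ?U. (- 1) ^ length (ys @ j # zs) *
        cq0 (path_prod a i (ys @ j # zs) i) * d (T - {i} - set (ys @ j # zs))) =
      (\<Sum>(xs, ys)\<in>distinct_list_pairs ?U. - ((- 1) ^ (length xs + length ys) *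
        cq0 (path_prod a i xs j * path_prod a j ys i) * d (?U - set xs - set ys)))"
  proof (intro sum.cong refl, clarify)
    fix xs ys
    have "T - {i} - set (xs @ j # ys) = ?U - set xs - set ys" by auto
    then show "(- 1) ^ length (xs @ j # ys) * cq0 (path_prod a i (xs @ j # ys) i) *
          d (T - {i} - set (xs @ j # ys)) =
        - ((- 1) ^ (length xs + length ys) *
          cq0 (path_prod a i xs j * path_prod a j ys i) * d (?U - set xs - set ys))"
      by (simp add: path_prod_append)
  qed
  finally show ?thesis
    by (simp add: sum.distrib[symmetric] case_prod_unfold algebra_simps)
qed

text \<open>Both claims go through one induction over proper subsets: reality of the minors permits
  the passage to real parts, and independence of the index permits expanding a minor at any chosen
  index.\<close>

lemma
  assumes "finite T" "hermitian_on a T"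
  shows cnj_rdet_on_hermitian: "cq_cnj (rdet_on a T) = rdet_on a T"
    and row_expansion_hermitian: "i \<in> T \<Longrightarrow> row_expansion a T i = rdet_on a T"
proof -
  have "cq_cnj (rdet_on a T) = rdet_on a T \<and> (\<forall>i\<in>T. row_expansion a T i = rdet_on a T)"
    using assms
  proof (induction T rule: finite_psubset_induct)
    case (psubset T)
    define d where "d U = cq0 (rdet_on a U)" for U
    have real: "rdet_on a U = of_real (d U)" if "U \<subset> T" for U
      unfolding d_def
      using psubset.IH[OF that] hermitian_on_subset[OF psubset.prems] that
      by (intro cq_cnj_fixed_imp_real) blast
    have trace: "row_expansion a U i = of_real (trace_expansion a d U i)" if "U \<subseteq> T" "i \<in> U" for U i
      using that hermitian_on_subset[OF psubset.prems that(1)]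
      by (intro row_expansion_eq_trace_expansion real) auto
    have minor: "d U = trace_expansion a d U i" if "U \<subset> T" "i \<in> U" for U i
    proof -
      have "row_expansion a U i = rdet_on a U"
        using psubset.IH[OF that(1)] hermitian_on_subset[OF psubset.prems] that by blast
      then show ?thesis
        using trace[of U i] real[OF that(1)] that by (metis of_real_eq_iff psubset_imp_subset)
    qed
    have indep: "trace_expansion a d T i = trace_expansion a d T j" if "i \<in> T" "j \<in> T" for i j
    proof (cases "i = j")
      case False
      have split: "trace_expansion a d T k =
          (\<Sum>(xs, ys)\<in>distinct_list_pairs (T - {k, l}). (- 1) ^ (length xs + length ys) *
            (cq0 (path_prod a k xs k) * cq0 (path_prod a l ys l) -
             cq0 (path_prod a k xs l * path_prod a l ys k)) * d (T - {k, l} - set xs - set ys))"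
        if "k \<in> T" "l \<in> T" "k \<noteq> l" for k l
        by (intro trace_expansion_split minor) (use that \<open>finite T\<close> in auto)
      have swap: "{j, i} = {i, j}" by auto
      show ?thesis
        unfolding split[OF that False] split[OF that(2,1) False[symmetric]] swap
      \<comment> \<open>Exchanging \<open>i\<close> with \<open>j\<close> and \<open>xs\<close> with
        \<open>ys\<close> preserves the product of two cycles; the cycle through both indices only
        changes its starting point.\<close>
      proof (subst sum_distinct_list_pairs_swap, intro sum.cong refl, clarify)
        fix xs ys
        have "T - {i, j} - set ys - set xs = T - {i, j} - set xs - set ys" by auto
        then show "(- 1) ^ (length ys + length xs) *
            (cq0 (path_prod a i ys i) * cq0 (path_prod a j xs j) -
              cq0 (path_prod a i ys j * path_prod a j xs i)) * d (T - {i, j} - set ys - set xs) =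
          (- 1) ^ (length xs + length ys) *
            (cq0 (path_prod a j xs j) * cq0 (path_prod a i ys i) -
              cq0 (path_prod a j xs i * path_prod a i ys j)) * d (T - {i, j} - set xs - set ys)"
          by (simp add: cq0_mult_commute[of "path_prod a i ys j"] ac_simps)
      qed
    qed simp
    show ?case
    proof (cases "T = {}")
      case False
      then have "Min T \<in> T" using \<open>finite T\<close> by simp
      then have "row_expansion a T i = rdet_on a T" if "i \<in> T" for i
        unfolding rdet_on_Min[OF \<open>finite T\<close> False]
        using trace[OF order_refl] indep that by metis
      moreover have "cq_cnj (rdet_on a T) = rdet_on a T"
        unfolding rdet_on_Min[OF \<open>finite T\<close> False] trace[OF order_refl \<open>Min T \<in> T\<close>] by simp
      ultimately show ?thesis by blast
    qed (simp add: perm_sum_empty)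
  qed
  then show "cq_cnj (rdet_on a T) = rdet_on a T"
    and "i \<in> T \<Longrightarrow> row_expansion a T i = rdet_on a T"
    by auto
qed

lemma rdet_on_hermitian_real:
  assumes "finite T" "hermitian_on a T"
  obtains r where "rdet_on a T = of_real r"
  using cq_cnj_fixed_imp_real[OF cnj_rdet_on_hermitian[OF assms]] by blast

text \<open>Row \<open>i\<close> enters a term of the expansion at \<open>i\<close> only through its
  first factor, so starting the path at \<open>k\<close> means replacing row \<open>i\<close> by row
  \<open>k\<close>.\<close>

lemma row_expansion_other_row:
  assumes "finite T" "hermitian_on a T" "i \<in> T" "k \<in> T" "i \<noteq> k"
  shows "(\<Sum>xs\<in>distinct_lists (T - {i}).
    (- 1) ^ length xs *\<^sub>R (path_prod a k xs i * rdet_on a (T - {i} - set xs))) = 0"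
proof -
  let ?U = "T - {i, k}"
  \<comment> \<open>The common value, up to sign, of both kinds of terms: the loop
    \<open>k, ys, k\<close> followed by the path \<open>k, xs, i\<close>.\<close>
  define g where "g ys xs = (- 1) ^ (length xs + length ys) *\<^sub>R
    (path_prod a k ys k * path_prod a k xs i * rdet_on a (?U - set xs - set ys))" for xs ys
  have U: "T - {i} - {k} = ?U" by auto
  have "(\<Sum>xs\<in>distinct_lists (T - {i}).
      (- 1) ^ length xs *\<^sub>R (path_prod a k xs i * rdet_on a (T - {i} - set xs))) =
      (\<Sum>xs\<in>distinct_lists ?U. (- 1) ^ length xs *\<^sub>R
        (path_prod a k xs i * rdet_on a (T - {i} - set xs))) +
      (\<Sum>(ys, xs)\<in>distinct_list_pairs ?U. (- 1) ^ length (ys @ k # xs) *\<^sub>R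
        (path_prod a k (ys @ k # xs) i * rdet_on a (T - {i} - set (ys @ k # xs))))"
    using assms by (subst sum_distinct_lists_split[of _ k]) (simp_all add: U)
  also have "(\<Sum>xs\<in>distinct_lists ?U. (- 1) ^ length xs *\<^sub>R
        (path_prod a k xs i * rdet_on a (T - {i} - set xs))) =
      (\<Sum>xs\<in>distinct_lists ?U. \<Sum>ys\<in>distinct_lists (?U - set xs). g ys xs)"
  proof (intro sum.cong refl)
    fix xs assume xs: "xs \<in> distinct_lists ?U"
    let ?V = "T - {i} - set xs"
    have herm: "hermitian_on a ?V" and fin: "finite ?V"
      using assms by (auto intro: hermitian_on_subset)
    have k: "k \<in> ?V" using xs assms by (auto simp: distinct_lists_def)
    have V: "?V - {k} = ?U - set xs" by auto
    obtain r where r: "rdet_on a ?V = of_real r"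
      using rdet_on_hermitian_real[OF fin herm] .
    \<comment> \<open>The real minor is central and moves in front of the path before it is expanded
      at \<open>k\<close>. The smaller minors are real as well and move back behind the
      path.\<close>
    have "path_prod a k xs i * rdet_on a ?V = row_expansion a ?V k * path_prod a k xs i"
      unfolding row_expansion_hermitian[OF fin herm k] r by (simp add: of_real_def)
    also have "\<dots> = (\<Sum>ys\<in>distinct_lists (?U - set xs). (- 1) ^ length ys *\<^sub>R
        (path_prod a k ys k * path_prod a k xs i * rdet_on a (?U - set xs - set ys)))"
      unfolding row_expansion_def V sum_distrib_right
    proof (intro sum.cong refl)
      fix ys
      have "finite (?U - set xs - set ys)" "hermitian_on a (?U - set xs - set ys)"
        using assms by (auto intro: hermitian_on_subset)
      then obtain s where "rdet_on a (?U - set xs - set ys) = of_real s"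
        using rdet_on_hermitian_real by blast
      then show "((- 1) ^ length ys *\<^sub>R (path_prod a k ys k * rdet_on a (?U - set xs - set ys))) *
          path_prod a k xs i = (- 1) ^ length ys *\<^sub>R
          (path_prod a k ys k * path_prod a k xs i * rdet_on a (?U - set xs - set ys))"
        by (simp add: of_real_def)
    qed
    finally show "(- 1) ^ length xs *\<^sub>R (path_prod a k xs i * rdet_on a ?V) =
        (\<Sum>ys\<in>distinct_lists (?U - set xs). g ys xs)"
      by (simp add: g_def scaleR_sum_right power_add)
  qed
  also have "\<dots> = (\<Sum>(ys, xs)\<in>distinct_list_pairs ?U. g ys xs)"
    using assms(1) by (subst sum_distinct_list_pairs_swap) (intro sum_distinct_list_pairs, simp)
  \<comment> \<open>A path that revisits \<open>k\<close> has one more element, hence the opposite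
    sign.\<close>
  also have "(\<Sum>(ys, xs)\<in>distinct_list_pairs ?U. (- 1) ^ length (ys @ k # xs) *\<^sub>R
        (path_prod a k (ys @ k # xs) i * rdet_on a (T - {i} - set (ys @ k # xs)))) =
      (\<Sum>(ys, xs)\<in>distinct_list_pairs ?U. - g ys xs)"
  proof (intro sum.cong refl, clarify)
    fix ys xs
    have "T - {i} - set (ys @ k # xs) = ?U - set xs - set ys" by auto
    then show "(- 1) ^ length (ys @ k # xs) *\<^sub>R
        (path_prod a k (ys @ k # xs) i * rdet_on a (T - {i} - set (ys @ k # xs))) = - g ys xs"
      by (simp add: g_def path_prod_append add.commute)
  qed
  finally show ?thesis
    by (simp add: case_prod_unfold sum_negf)
qed

section \<open>Cofactors and inverses\<close>

text \<open>A path without its first factor; the empty list gives 1 because its path is a single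
  entry.\<close>

definition path_rest :: "('a \<Rightarrow> 'a \<Rightarrow> coquat) \<Rightarrow> 'a list \<Rightarrow> 'a \<Rightarrow> coquat" where
  "path_rest a xs y = (case xs of [] \<Rightarrow> 1 | z # zs \<Rightarrow> path_prod a z zs y)"

lemma path_prod_eq_path_rest: "path_prod a x xs y = a x (hd (xs @ [y])) * path_rest a xs y"
  by (cases xs) (simp_all add: path_rest_def)

text \<open>Collects the terms of the row expansion whose first factor lies in column
  \<open>j\<close>, with that factor removed. The column is \<open>hd (xs @ [i])\<close>, which is
  \<open>i\<close> itself for a fixed point. No entry of row \<open>i\<close> is left.\<close>

definition row_cofactor :: "(nat \<Rightarrow> nat \<Rightarrow> coquat) \<Rightarrow> nat set \<Rightarrow> nat \<Rightarrow> nat \<Rightarrow> coquat" where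
  "row_cofactor a T i j = (\<Sum>xs | xs \<in> distinct_lists (T - {i}) \<and> hd (xs @ [i]) = j.
     (- 1) ^ length xs *\<^sub>R (path_rest a xs i * rdet_on a (T - {i} - set xs)))"

lemma sum_row_cofactor:
  assumes "finite T" "i \<in> T"
  shows "(\<Sum>j\<in>T. b j * row_cofactor a T i j) = (\<Sum>xs\<in>distinct_lists (T - {i}).
    (- 1) ^ length xs *\<^sub>R (b (hd (xs @ [i])) * path_rest a xs i * rdet_on a (T - {i} - set xs)))"
proof -
  let ?h = "\<lambda>xs. hd (xs @ [i])"
  let ?f = "\<lambda>xs. (- 1) ^ length xs *\<^sub>R (b (?h xs) * path_rest a xs i * rdet_on a (T - {i} - set xs))"
  have "?h xs \<in> T" if "xs \<in> distinct_lists (T - {i})" for xs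
    using that assms(2) by (cases xs) (auto simp: distinct_lists_def)
  then have "?h ` distinct_lists (T - {i}) \<subseteq> T" by blast
  then have "sum ?f (distinct_lists (T - {i})) =
      (\<Sum>j\<in>T. sum ?f {xs \<in> distinct_lists (T - {i}). ?h xs = j})"
    using assms by (intro sum.group[symmetric]) (auto simp: finite_distinct_lists)
  also have "\<dots> = (\<Sum>j\<in>T. b j * row_cofactor a T i j)"
    unfolding row_cofactor_def sum_distrib_left by (intro sum.cong refl) (auto simp: mult.assoc)
  finally show ?thesis ..
qed

lemma sum_row_cofactor_hermitian:
  assumes "finite T" "hermitian_on a T" "i \<in> T" "k \<in> T"
  shows "(\<Sum>j\<in>T. a k j * row_cofactor a T i j) = (if k = i then rdet_on a T else 0)"
proof -
  have "(\<Sum>j\<in>T. a k j * row_cofactor a T i j) = (\<Sum>xs\<in>distinct_lists (T - {i}).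
      (- 1) ^ length xs *\<^sub>R (path_prod a k xs i * rdet_on a (T - {i} - set xs)))"
    by (simp add: sum_row_cofactor[OF assms(1,3)] path_prod_eq_path_rest)
  then show ?thesis
    using row_expansion_hermitian[OF assms(1,2,3)] row_expansion_other_row[OF assms]
    by (auto simp: row_expansion_def)
qed

section \<open>Transfer to matrices with a replaced row or column\<close>

abbreviation (input) mat_entry :: "'a mat \<Rightarrow> nat \<Rightarrow> nat \<Rightarrow> 'a" where
  "mat_entry A \<equiv> \<lambda>i j. A $$ (i, j)"

abbreviation mat_cofactor :: "coquat mat \<Rightarrow> nat \<Rightarrow> nat \<Rightarrow> coquat" where
  "mat_cofactor A \<equiv> row_cofactor (mat_entry A) {0..<dim_row A}"

text \<open>The cofactors along row \<open>i\<close> do not involve row \<open>i\<close>, so the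
  replacement affects only the first factors.\<close>

lemma rdet_replace_row:
  assumes A: "A \<in> carrier_mat n n" and "i < n"
  shows "rdet i (replace_row A b i) = (\<Sum>j<n. b $ j * mat_cofactor A i j)"
proof -
  let ?R = "replace_row A b i" and ?T = "{0..<n}"
  have dim: "dim_row ?R = n" "dim_row A = n" using A by (auto simp: replace_row_def)
  have entry: "?R $$ (u, v) = (if u = i then b $ v else A $$ (u, v))" if "u < n" "v < n" for u v
    using that A by (simp add: replace_row_def)
  have "rdet i ?R = row_expansion (mat_entry ?R) ?T i"
    using rdet_eq_row_expansion[of i ?R] \<open>i < n\<close> by (simp add: dim)
  also have "\<dots> = (\<Sum>xs\<in>distinct_lists (?T - {i}). (- 1) ^ length xs *\<^sub>R
      (b $ (hd (xs @ [i])) * path_rest (mat_entry A) xs i * rdet_on (mat_entry A) (?T - {i} - set xs)))"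
    unfolding row_expansion_def
  proof (intro sum.cong refl)
    fix xs assume "xs \<in> distinct_lists (?T - {i})"
    then have xs: "set xs \<subseteq> ?T - {i}" by (simp add: distinct_lists_def)
    have "hd (xs @ [i]) < n" using xs \<open>i < n\<close> by (cases xs) auto
    then have "?R $$ (i, hd (xs @ [i])) = b $ (hd (xs @ [i]))"
      using entry \<open>i < n\<close> by simp
    moreover have "path_rest (mat_entry ?R) xs i = path_rest (mat_entry A) xs i"
    proof (cases xs)
      case (Cons z zs)
      have "path_prod (mat_entry ?R) z zs i = path_prod (mat_entry A) z zs i"
      proof (rule path_prod_cong)
        fix u v assume "u \<in> insert z (set zs)" "v \<in> insert i (set zs)"
        then have "u < n" "u \<noteq> i" "v < n" using xs Cons \<open>i < n\<close> by auto
        then show "?R $$ (u, v) = A $$ (u, v)" by (simp add: entry)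
      qed
      with Cons show ?thesis by (simp add: path_rest_def)
    qed (simp add: path_rest_def)
    moreover have "rdet_on (mat_entry ?R) (?T - {i} - set xs) = rdet_on (mat_entry A) (?T - {i} - set xs)"
      by (rule rdet_on_cong) (auto simp: entry)
    ultimately show "(- 1) ^ length xs *\<^sub>R (path_prod (mat_entry ?R) i xs i *
          rdet_on (mat_entry ?R) (?T - {i} - set xs)) =
        (- 1) ^ length xs *\<^sub>R (b $ (hd (xs @ [i])) * path_rest (mat_entry A) xs i *
          rdet_on (mat_entry A) (?T - {i} - set xs))"
      by (simp add: path_prod_eq_path_rest)
  qed
  also have "\<dots> = (\<Sum>j<n. b $ j * mat_cofactor A i j)"
    using sum_row_cofactor[of ?T i "\<lambda>j. b $ j" "mat_entry A"] \<open>i < n\<close> by (simp add: dim atLeast0LessThan)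
  finally show ?thesis .
qed

lemma cq_hermitian_entry:
  assumes "cq_hermitian A" "A \<in> carrier_mat n n" "u < n" "v < n"
  shows "A $$ (v, u) = cq_cnj (A $$ (u, v))"
proof -
  have "A $$ (v, u) = cq_adjoint A $$ (v, u)" using assms(1) by (simp add: cq_hermitian_def)
  also have "\<dots> = cq_cnj (A $$ (u, v))" using assms(2-4) by (simp add: cq_adjoint_def)
  finally show ?thesis .
qed

lemma hermitian_on_mat_entry:
  assumes "cq_hermitian A" "A \<in> carrier_mat n n"
  shows "hermitian_on (mat_entry A) {0..<n}"
  unfolding hermitian_on_def by (intro ballI cq_hermitian_entry[OF assms]) auto

lemma cdet_eq_cnj_rdet:
  assumes "A \<in> carrier_mat n n" "B \<in> carrier_mat n n" "i < n"
    and "\<And>u v. u < n \<Longrightarrow> v < n \<Longrightarrow> B $$ (v, u) = cq_cnj (A $$ (u, v))"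
  shows "cdet i B = cq_cnj (rdet i A)"
proof -
  have "col_expansion (mat_entry B) {0..<n} i = cq_cnj (row_expansion (mat_entry A) {0..<n} i)"
    using assms by (intro col_expansion_eq_cnj_row_expansion) auto
  then show ?thesis
    using assms cdet_eq_col_expansion[of i B] rdet_eq_row_expansion[of i A] by simp
qed

text \<open>For Hermitian \<open>A\<close>, conjugate transposition turns the replaced column into a
  replaced row with conjugated entries.\<close>

lemma cdet_replace_col:
  assumes A: "A \<in> carrier_mat n n" "cq_hermitian A" and "i < n" "c \<in> carrier_vec n"
  shows "cdet i (replace_col A c i) = (\<Sum>j<n. cq_cnj (mat_cofactor A i j) * c $ j)"
proof -
  have "cdet i (replace_col A c i) = cq_cnj (rdet i (replace_row A (map_vec cq_cnj c) i))"
  proof (rule cdet_eq_cnj_rdet)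
    show "replace_row A (map_vec cq_cnj c) i \<in> carrier_mat n n" "replace_col A c i \<in> carrier_mat n n"
      using A by (auto simp: replace_row_def replace_col_def)
    show "replace_col A c i $$ (v, u) = cq_cnj (replace_row A (map_vec cq_cnj c) i $$ (u, v))"
      if "u < n" "v < n" for u v
      using A \<open>c \<in> carrier_vec n\<close> that cq_hermitian_entry[OF A(2,1) that]
      by (simp add: replace_row_def replace_col_def)
  qed fact
  also have "\<dots> = (\<Sum>j<n. cq_cnj (mat_cofactor A i j) * c $ j)"
    using \<open>c \<in> carrier_vec n\<close> unfolding rdet_replace_row[OF A(1) \<open>i < n\<close>] cq_cnj_sum
    by (intro sum.cong refl) simp
  finally show ?thesis .
qed

text \<open>Justifies the definite description in \<open>hdet\<close>: all row and column
  determinants equal the same real number.\<close>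

lemma of_real_hdet:
  assumes A: "A \<in> carrier_mat n n" "cq_hermitian A" and "n \<ge> 1"
  shows "of_real (hdet A) = rdet_on (mat_entry A) {0..<n}"
proof -
  have herm: "hermitian_on (mat_entry A) {0..<n}" by (rule hermitian_on_mat_entry[OF A(2,1)])
  obtain r where r: "rdet_on (mat_entry A) {0..<n} = of_real r"
    using rdet_on_hermitian_real[OF _ herm] by auto
  have rdet: "rdet i A = of_real r" if "i < n" for i
    using row_expansion_hermitian[OF _ herm, of i] rdet_eq_row_expansion[of i A] that A r by simp
  moreover have cdet: "cdet i A = of_real r" if "i < n" for i
    using cdet_eq_cnj_rdet[OF A(1,1) that cq_hermitian_entry[OF A(2,1)]] rdet[OF that] by simp
  ultimately have "hdet A = r"
    unfolding hdet_def
  proof (intro the_equality)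
    \<comment> \<open>Uniqueness needs at least one index; \<open>n \<ge> 1\<close> supplies the
      index 0.\<close>
    fix d assume "\<forall>i<dim_row A. rdet i A = of_real d \<and> cdet i A = of_real d"
    then have "of_real d = (of_real r :: coquat)"
      using rdet[of 0] \<open>n \<ge> 1\<close> A by auto
    then show "d = r" by simp
  qed (use A in auto)
  with r show ?thesis by simp
qed

section \<open>One-sided inverses built from cofactors\<close>

definition right_inverse_mat :: "coquat mat \<Rightarrow> coquat mat" where
  "right_inverse_mat A =
     mat (dim_row A) (dim_row A) (\<lambda>(j, i). mat_cofactor A i j /\<^sub>R hdet A)"

text \<open>The conjugate transpose of \<open>right_inverse_mat A\<close>, since
  \<open>hdet A\<close> is real.\<close>

definition left_inverse_mat :: "coquat mat \<Rightarrow> coquat mat" where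
  "left_inverse_mat A =
     mat (dim_row A) (dim_row A) (\<lambda>(i, j). cq_cnj (mat_cofactor A i j) /\<^sub>R hdet A)"

lemma sum_mat_cofactor:
  assumes A: "A \<in> carrier_mat n n" "cq_hermitian A" and "i < n" "k < n"
  shows "(\<Sum>j<n. A $$ (k, j) * mat_cofactor A i j) = (if k = i then of_real (hdet A) else 0)"
  using sum_row_cofactor_hermitian[OF _ hermitian_on_mat_entry[OF A(2,1)], of i k]
    of_real_hdet[OF A] assms by (simp add: atLeast0LessThan)

lemma mult_right_inverse_mat:
  assumes A: "A \<in> carrier_mat n n" "cq_hermitian A" and "hdet A \<noteq> 0"
  shows "A * right_inverse_mat A = 1\<^sub>m n"
proof (rule eq_matI)
  fix k i assume "k < dim_row (1\<^sub>m n :: coquat mat)" "i < dim_col (1\<^sub>m n :: coquat mat)"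
  then have ki: "k < n" "i < n" by auto
  have "(A * right_inverse_mat A) $$ (k, i) =
      (\<Sum>j<n. A $$ (k, j) * mat_cofactor A i j) /\<^sub>R hdet A"
    using A(1) ki
    by (simp add: right_inverse_mat_def scalar_prod_def scaleR_sum_right atLeast0LessThan)
  also have "\<dots> = 1\<^sub>m n $$ (k, i)"
    using ki \<open>hdet A \<noteq> 0\<close> by (simp add: sum_mat_cofactor[OF A] of_real_def)
  finally show "(A * right_inverse_mat A) $$ (k, i) = 1\<^sub>m n $$ (k, i)" .
qed (use A in \<open>auto simp: right_inverse_mat_def\<close>)

lemma left_inverse_mat_mult:
  assumes A: "A \<in> carrier_mat n n" "cq_hermitian A" and "hdet A \<noteq> 0"
  shows "left_inverse_mat A * A = 1\<^sub>m n"
proof (rule eq_matI)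
  fix i k assume "i < dim_row (1\<^sub>m n :: coquat mat)" "k < dim_col (1\<^sub>m n :: coquat mat)"
  then have ki: "k < n" "i < n" by auto
  have "(left_inverse_mat A * A) $$ (i, k) =
      (\<Sum>j<n. cq_cnj (mat_cofactor A i j) * A $$ (j, k)) /\<^sub>R hdet A"
    using A(1) ki
    by (simp add: left_inverse_mat_def scalar_prod_def scaleR_sum_right atLeast0LessThan)
  \<comment> \<open>As \<open>A\<close> is Hermitian, this is the conjugate of the sum that gives
    the right inverse.\<close>
  also have "(\<Sum>j<n. cq_cnj (mat_cofactor A i j) * A $$ (j, k)) =
      cq_cnj (\<Sum>j<n. A $$ (k, j) * mat_cofactor A i j)"
    unfolding cq_cnj_sum
  proof (intro sum.cong refl)
    fix j assume "j \<in> {..<n}"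
    then have "A $$ (j, k) = cq_cnj (A $$ (k, j))"
      using cq_hermitian_entry[OF A(2,1) ki(1)] by simp
    then show "cq_cnj (mat_cofactor A i j) * A $$ (j, k) =
        cq_cnj (A $$ (k, j) * mat_cofactor A i j)" by simp
  qed
  also have "\<dots> /\<^sub>R hdet A = 1\<^sub>m n $$ (i, k)"
    using ki \<open>hdet A \<noteq> 0\<close> by (simp add: sum_mat_cofactor[OF A] of_real_def)
  finally show "(left_inverse_mat A * A) $$ (i, k) = 1\<^sub>m n $$ (i, k)" .
qed (use A in \<open>auto simp: left_inverse_mat_def\<close>)

lemma inverse_mat_carrier:
  assumes "A \<in> carrier_mat n n"
  shows "right_inverse_mat A \<in> carrier_mat n n" "left_inverse_mat A \<in> carrier_mat n n"
  using assms by (auto simp: right_inverse_mat_def left_inverse_mat_def)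

lemma left_right_inverse_mat_unique:
  fixes A :: "'a :: semiring_1 mat"
  assumes "A \<in> carrier_mat n n" "L \<in> carrier_mat n n" "R \<in> carrier_mat n n"
    and "L * A = 1\<^sub>m n" "A * R = 1\<^sub>m n"
  shows "L = R"
proof -
  have "L = L * (A * R)" using assms by simp
  also have "\<dots> = L * A * R" using assms(1-3) by (intro assoc_mult_mat[symmetric])
  finally show ?thesis using assms by simp
qed

text \<open>Cramer's rule: the sum of the conjugated cofactors against a column of \<open>M\<close>
  is the column determinant with that column inserted.\<close>

lemma left_inverse_mat_mult_index:
  assumes A: "A \<in> carrier_mat n n" "cq_hermitian A"
    and M: "M \<in> carrier_mat n p" and "i < n" "l < p"
  shows "(left_inverse_mat A * M) $$ (i, l) = cdet i (replace_col A (col M l) i) /\<^sub>R hdet A"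
  using assms cdet_replace_col[OF A \<open>i < n\<close>, of "col M l"]
  by (simp add: left_inverse_mat_def scalar_prod_def scaleR_sum_right atLeast0LessThan)

lemma mult_right_inverse_mat_index:
  assumes B: "B \<in> carrier_mat n n"
    and M: "M \<in> carrier_mat p n" and "l < p" "j < n"
  shows "(M * right_inverse_mat B) $$ (l, j) = rdet j (replace_row B (row M l) j) /\<^sub>R hdet B"
  using assms rdet_replace_row[OF B \<open>j < n\<close>, of "row M l"]
  by (simp add: right_inverse_mat_def scalar_prod_def scaleR_sum_right atLeast0LessThan)

text \<open>Real scalars pass through the replaced row; this extracts the inner factor
  \<open>1 / hdet A\<close> from nested determinants.\<close>

lemma rdet_replace_row_scaleR:
  assumes B: "B \<in> carrier_mat n n" and "j < n" "\<And>l. l < n \<Longrightarrow> v $ l = r *\<^sub>R w $ l"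
  shows "rdet j (replace_row B v j) = r *\<^sub>R rdet j (replace_row B w j)"
  unfolding rdet_replace_row[OF assms(1,2)] using assms(3) by (simp add: scaleR_sum_right)

lemma cdet_replace_col_scaleR:
  assumes A: "A \<in> carrier_mat n n" "cq_hermitian A" and "i < n" "v \<in> carrier_vec n" "w \<in> carrier_vec n"
    and "\<And>l. l < n \<Longrightarrow> v $ l = r *\<^sub>R w $ l"
  shows "cdet i (replace_col A v i) = r *\<^sub>R cdet i (replace_col A w i)"
  unfolding cdet_replace_col[OF assms(1-4)] cdet_replace_col[OF assms(1-3,5)]
  using assms(6) by (simp add: scaleR_sum_right)

section \<open>Cramer's rule for the two-sided equation\<close>

theorem theorem5p1:
  fixes A B C :: "coquat mat" and m n :: nat
  assumes "m \<ge> 1" and "n \<ge> 1"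
    and "A \<in> carrier_mat m m" and "B \<in> carrier_mat n n" and "C \<in> carrier_mat m n"
    and "cq_hermitian A" and "cq_hermitian B"
    and "hdet A \<noteq> 0" and "hdet B \<noteq> 0"
  shows "(\<exists>!X. X \<in> carrier_mat m n \<and> A * X * B = C) \<and>
    (\<forall>X \<in> carrier_mat m n. A * X * B = C \<longrightarrow>
      (\<forall>i<m. \<forall>j<n.
        X $$ (i, j) =
          rdet j (replace_row B (vec n (\<lambda>l. cdet i (replace_col A (col C l) i))) j)
            /\<^sub>R (hdet A * hdet B) \<and>
        X $$ (i, j) =
          cdet i (replace_col A (vec m (\<lambda>l. rdet j (replace_row B (row C l) j))) i)
            /\<^sub>R (hdet A * hdet B)))"
proof -
  note A = \<open>A \<in> carrier_mat m m\<close> \<open>cq_hermitian A\<close>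
    and B = \<open>B \<in> carrier_mat n n\<close> \<open>cq_hermitian B\<close> and C = \<open>C \<in> carrier_mat m n\<close>
  \<comment> \<open>The left inverse of \<open>A\<close> yields column determinants and the right
    inverse of \<open>B\<close> yields row determinants, as in the two formulas.\<close>
  define L where "L = left_inverse_mat A"
  define R where "R = right_inverse_mat B"
  have L: "L \<in> carrier_mat m m" and R: "R \<in> carrier_mat n n"
    unfolding L_def R_def using A B by (auto intro: inverse_mat_carrier)
  have LA: "L * A = 1\<^sub>m m" and BR: "B * R = 1\<^sub>m n"
    unfolding L_def R_def using left_inverse_mat_mult[OF A] mult_right_inverse_mat[OF B] assms by auto
  \<comment> \<open>A left and a right inverse of the same matrix coincide, so \<open>L\<close>, and
    likewise \<open>R\<close> below, is two-sided.\<close>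
  have AL: "A * L = 1\<^sub>m m"
  proof -
    have AR: "A * right_inverse_mat A = 1\<^sub>m m"
      by (rule mult_right_inverse_mat[OF A \<open>hdet A \<noteq> 0\<close>])
    show ?thesis
      unfolding left_right_inverse_mat_unique[OF A(1) L inverse_mat_carrier(1)[OF A(1)] LA AR] by (rule AR)
  qed
  have RB: "R * B = 1\<^sub>m n"
  proof -
    have LB: "left_inverse_mat B * B = 1\<^sub>m n"
      by (rule left_inverse_mat_mult[OF B \<open>hdet B \<noteq> 0\<close>])
    show ?thesis
      unfolding left_right_inverse_mat_unique[OF B(1) inverse_mat_carrier(2)[OF B(1)] R LB BR, symmetric]
      by (rule LB)
  qed
  have sol: "A * (L * C * R) * B = C"
  proof -
    have "A * (L * C * R) * B = A * (L * C * R * B)"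
      using A(1) B(1) C L R by (intro assoc_mult_mat[of _ m m _ n _ n]) auto
    also have "L * C * R * B = L * C * (R * B)"
      using B(1) C L R by (intro assoc_mult_mat[of _ m n _ n _ n]) auto
    also have "A * (L * C * (R * B)) = A * L * C"
      using A(1) C L by (simp add: RB assoc_mult_mat[of A m m L m C n])
    finally show ?thesis using C by (simp add: AL)
  qed
  have uniq: "X = L * C * R" if X: "X \<in> carrier_mat m n" and "A * X * B = C" for X
  proof -
    have "L * (A * X) * B = L * C"
      using A(1) B(1) L X by (subst assoc_mult_mat[of L m m "A * X" n B n]) (simp_all add: that(2))
    then have "L * C * R = L * (A * X) * B * R" by (simp only:)
    also have "\<dots> = L * (A * X) * (B * R)"
      using A(1) B(1) L R X by (intro assoc_mult_mat[of _ m n _ n _ n]) auto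
    also have "\<dots> = L * A * X"
      using A(1) L X by (simp add: BR assoc_mult_mat[of L m m A m X n])
    finally show ?thesis using X by (simp add: LA)
  qed
  have entries: "(L * C * R) $$ (i, j) =
        rdet j (replace_row B (vec n (\<lambda>l. cdet i (replace_col A (col C l) i))) j)
          /\<^sub>R (hdet A * hdet B) \<and>
      (L * C * R) $$ (i, j) =
        cdet i (replace_col A (vec m (\<lambda>l. rdet j (replace_row B (row C l) j))) i)
          /\<^sub>R (hdet A * hdet B)" if ij: "i < m" "j < n" for i j
  proof
    \<comment> \<open>Bracketing as \<open>(L * C) * R\<close> makes the row determinant of
      \<open>B\<close> the outer one; row \<open>i\<close> of \<open>L * C\<close> consists of
      column determinants divided by \<open>hdet A\<close>.\<close>
    have "(L * C * R) $$ (i, j) = rdet j (replace_row B (row (L * C) i) j) /\<^sub>R hdet B"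
      unfolding R_def using B(1) C L ij by (intro mult_right_inverse_mat_index) auto
    also have "rdet j (replace_row B (row (L * C) i) j) = inverse (hdet A) *\<^sub>R
        rdet j (replace_row B (vec n (\<lambda>l. cdet i (replace_col A (col C l) i))) j)"
    proof (rule rdet_replace_row_scaleR[OF B(1) ij(2)])
      fix l assume "l < n"
      then show "row (L * C) i $ l =
          inverse (hdet A) *\<^sub>R vec n (\<lambda>l. cdet i (replace_col A (col C l) i)) $ l"
        using left_inverse_mat_mult_index[OF A C ij(1)] C L ij by (simp add: L_def[symmetric])
    qed
    finally show "(L * C * R) $$ (i, j) =
        rdet j (replace_row B (vec n (\<lambda>l. cdet i (replace_col A (col C l) i))) j)
          /\<^sub>R (hdet A * hdet B)"
      by (simp add: mult.commute)
    \<comment> \<open>The other bracketing makes the column determinant of \<open>A\<close> the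
      outer one and gives the second formula.\<close>
    have "L * C * R = L * (C * R)"
      using C L R by (intro assoc_mult_mat[of _ m m _ n _ n]) auto
    then have "(L * C * R) $$ (i, j) = cdet i (replace_col A (col (C * R) j) i) /\<^sub>R hdet A"
      unfolding L_def using A C R ij by (simp add: left_inverse_mat_mult_index[where p = n])
    also have "cdet i (replace_col A (col (C * R) j) i) = inverse (hdet B) *\<^sub>R
        cdet i (replace_col A (vec m (\<lambda>l. rdet j (replace_row B (row C l) j))) i)"
    proof (rule cdet_replace_col_scaleR[OF A ij(1)])
      fix l assume "l < m"
      then show "col (C * R) j $ l =
          inverse (hdet B) *\<^sub>R vec m (\<lambda>l. rdet j (replace_row B (row C l) j)) $ l"
        using mult_right_inverse_mat_index[OF B(1) C _ ij(2)] C R ij by (simp add: R_def[symmetric])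
    qed (use C R ij in auto)
    finally show "(L * C * R) $$ (i, j) =
        cdet i (replace_col A (vec m (\<lambda>l. rdet j (replace_row B (row C l) j))) i)
          /\<^sub>R (hdet A * hdet B)"
      by simp
  qed
  show ?thesis
  proof (intro conjI ballI impI allI)
    show "\<exists>!X. X \<in> carrier_mat m n \<and> A * X * B = C"
    proof (rule ex1I)
      show "L * C * R \<in> carrier_mat m n \<and> A * (L * C * R) * B = C"
        using sol C L R by simp
    qed (use uniq in blast)
  next
    fix X i j assume "X \<in> carrier_mat m n" "A * X * B = C" "i < m" "j < n"
    then show "X $$ (i, j) =
        rdet j (replace_row B (vec n (\<lambda>l. cdet i (replace_col A (col C l) i))) j)
          /\<^sub>R (hdet A * hdet B)"
      unfolding uniq[OF \<open>X \<in> carrier_mat m n\<close> \<open>A * X * B = C\<close>] using entries by blast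
  next
    fix X i j assume "X \<in> carrier_mat m n" "A * X * B = C" "i < m" "j < n"
    then show "X $$ (i, j) =
        cdet i (replace_col A (vec m (\<lambda>l. rdet j (replace_row B (row C l) j))) i)
          /\<^sub>R (hdet A * hdet B)"
      unfolding uniq[OF \<open>X \<in> carrier_mat m n\<close> \<open>A * X * B = C\<close>] using entries by blast
  qed
qed

end
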